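(* There exists an absolute constant $c>0$ such that the following holds. Let $n\ge2$ be an integer and $L,\sigma,\Delta,\varepsilon>0$; set $\alpha=\min\{1,\frac{(\sqrt3+1)n\sigma}{30L},\frac{n}{180}\}$ and assume $\varepsilon^2\le\frac{\Delta L\alpha}{81648\,n}$. Then for every PIFO algorithm $\mathcal{A}$ whose proximal parameters satisfy $1/\gamma_t>\sigma$ for all $t$, there exist the dimension $d=\lfloor\frac{\Delta L\sqrt\alpha}{40824\,n\varepsilon^2}\rfloor+1$ and functions $f_1,\dots,f_n:\mathbb{R}^d\to\mathbb{R}$, each $(-\sigma,L)$-smooth, such that $f=\frac1n\sum_i f_i$ satisfies $f(x_0)-\inf_x f(x)\le\Delta$ ($x_0$ the initial point of $\mathcal{A}$) and the iterates of $\mathcal{A}$ satisfy $\mathbb{E}\|\nabla f(x_t)\|_2\ge\varepsilon$ for all integers $0\le t\le c\,\frac{\Delta L\sqrt\alpha}{\varepsilon^2}$. That is, $\mathcal{A}$ needs $\Omega(\Delta L\sqrt\alpha/\varepsilon^2)$ queries to find $\hat x$ with $\mathbb{E}\|\nabla f(\hat x)\|_2<\varepsilon$.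
   Context: A differentiable $g:\mathbb{R}^d\to\mathbb{R}$ is $(l,L)$-smooth ($l\in\mathbb{R}$, $L>0$) if for all $x,y$: $\frac l2\|x-y\|_2^2\le g(x)-g(y)-\langle\nabla g(y),x-y\rangle\le\frac L2\|x-y\|_2^2$. For $\gamma>0$, $\mathrm{prox}^{\gamma}_g(x)=\arg\min_u\{g(u)+\frac{1}{2\gamma}\|x-u\|_2^2\}$ (for $(-\sigma,L)$-smooth $g$ and $1/\gamma>\sigma$ this objective is strongly convex so the prox is well defined). PIFO algorithm: given $f_1,\dots,f_n$ and $f=\frac1n\sum_if_i$, $\mathcal{A}$ is specified by a probability vector $(p_1,\dots,p_n)$, an initial point $x_0$ and parameters $\gamma_t>0$; it draws indices $i_1,i_2,\dots$ independently with $\mathbb{P}(i_t=j)=p_j$, at step $t\ge1$ queries $h_f(x_{t-1},i_t,\gamma_t)=[f_{i_t}(x_{t-1}),\nabla f_{i_t}(x_{t-1}),\mathrm{prox}^{\gamma_t}_{f_{i_t}}(x_{t-1})]$, and outputs $x_t\in\mathrm{span}\{x_0,\dots,x_{t-1},\nabla f_{i_1}(x_0),\dots,\nabla f_{i_t}(x_{t-1}),\mathrm{prox}^{\gamma_1}_{f_{i_1}}(x_0),\dots,\mathrm{prox}^{\gamma_t}_{f_{i_t}}(x_{t-1})\}$ (the choice within the span may depend on all observed information). Iterate $x_t$ uses $t$ queries. *)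

theory Defs
  imports Complex_Main "HOL-Library.FuncSet"
begin

text \<open>Euclidean space R^d is represented concretely, for a natural number d, as the
  set of vectors nat => real vanishing outside the coordinates 0..d-1, with the standard
  inner product and Euclidean norm on these coordinates. This lets the dimension d
  depend on the parameters while the constant c stays absolute.\<close>

type_synonym vec = "nat \<Rightarrow> real"

definition vsp :: "nat \<Rightarrow> vec set" where
  "vsp d = {x. \<forall>i\<ge>d. x i = 0}"

definition ip :: "nat \<Rightarrow> vec \<Rightarrow> vec \<Rightarrow> real" where
  "ip d x y = (\<Sum>i<d. x i * y i)"

definition nrm :: "nat \<Rightarrow> vec \<Rightarrow> real" where
  "nrm d x = sqrt (ip d x x)"

definition vadd :: "vec \<Rightarrow> vec \<Rightarrow> vec" where
  "vadd x y = (\<lambda>i. x i + y i)"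

definition vsub :: "vec \<Rightarrow> vec \<Rightarrow> vec" where
  "vsub x y = (\<lambda>i. x i - y i)"

definition has_grad :: "nat \<Rightarrow> (vec \<Rightarrow> real) \<Rightarrow> vec \<Rightarrow> vec \<Rightarrow> bool" where
  "has_grad d g G x \<longleftrightarrow> G \<in> vsp d \<and>
     (\<forall>e>0. \<exists>\<delta>>0. \<forall>h\<in>vsp d. nrm d h < \<delta> \<longrightarrow>
        \<bar>g (vadd x h) - g x - ip d G h\<bar> \<le> e * nrm d h)"

definition grad :: "nat \<Rightarrow> (vec \<Rightarrow> real) \<Rightarrow> vec \<Rightarrow> vec" where
  "grad d g x = (THE G. has_grad d g G x)"

definition differentiable_vsp :: "nat \<Rightarrow> (vec \<Rightarrow> real) \<Rightarrow> bool" where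
  "differentiable_vsp d g \<longleftrightarrow> (\<forall>x\<in>vsp d. \<exists>G. has_grad d g G x)"

definition smooth :: "nat \<Rightarrow> real \<Rightarrow> real \<Rightarrow> (vec \<Rightarrow> real) \<Rightarrow> bool" where
  "smooth d l L g \<longleftrightarrow> differentiable_vsp d g \<and>
     (\<forall>x\<in>vsp d. \<forall>y\<in>vsp d.
        l / 2 * (nrm d (vsub x y))\<^sup>2 \<le> g x - g y - ip d (grad d g y) (vsub x y) \<and>
        g x - g y - ip d (grad d g y) (vsub x y) \<le> L / 2 * (nrm d (vsub x y))\<^sup>2)"

definition prox :: "nat \<Rightarrow> real \<Rightarrow> (vec \<Rightarrow> real) \<Rightarrow> vec \<Rightarrow> vec" where
  "prox d \<gamma> g x = (THE u. u \<in> vsp d \<and>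
     (\<forall>v\<in>vsp d. g u + 1 / (2 * \<gamma>) * (nrm d (vsub x u))\<^sup>2
                 \<le> g v + 1 / (2 * \<gamma>) * (nrm d (vsub x v))\<^sup>2))"

definition lspan :: "vec list \<Rightarrow> vec set" where
  "lspan vs = {x. \<exists>a :: nat \<Rightarrow> real. x = (\<lambda>j. \<Sum>k<length vs. a k * (vs ! k) j)}"

text \<open>An observation: (index i_t, f_{i_t}(x_{t-1}), gradient, prox).\<close>
type_synonym obs = "nat \<times> real \<times> vec \<times> vec"

definition obs_grad :: "obs \<Rightarrow> vec" where
  "obs_grad o1 = fst (snd (snd o1))"

definition obs_prox :: "obs \<Rightarrow> vec" where
  "obs_prox o1 = snd (snd (snd o1))"

definition pifo :: "nat \<Rightarrow> nat \<Rightarrow> (nat \<Rightarrow> real) \<Rightarrow> vec \<Rightarrow> (nat \<Rightarrow> real)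
                      \<Rightarrow> (obs list \<Rightarrow> vec) \<Rightarrow> bool" where
  "pifo n d p x0 gam upd \<longleftrightarrow>
     (\<forall>i<n. p i \<ge> 0) \<and> (\<Sum>i<n. p i) = 1 \<and> x0 \<in> vsp d \<and> (\<forall>t\<ge>1. gam t > 0) \<and>
     (\<forall>os. length os \<ge> 1 \<longrightarrow>
        upd os \<in> lspan (x0 # map (\<lambda>k. upd (take k os)) [1..<length os]
                        @ map obs_grad os @ map obs_prox os))"

definition pifo_query :: "nat \<Rightarrow> (nat \<Rightarrow> vec \<Rightarrow> real) \<Rightarrow> real \<Rightarrow> nat \<Rightarrow> vec \<Rightarrow> obs" where
  "pifo_query d F g i x = (i, F i x, grad d (F i) x, prox d g (F i) x)"

text \<open>History of observations after t queries, for index sequence I (I k = i_{k+1}).\<close>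
primrec run :: "nat \<Rightarrow> (nat \<Rightarrow> vec \<Rightarrow> real) \<Rightarrow> (nat \<Rightarrow> real) \<Rightarrow> vec \<Rightarrow> (obs list \<Rightarrow> vec)
                 \<Rightarrow> (nat \<Rightarrow> nat) \<Rightarrow> nat \<Rightarrow> obs list" where
  "run d F gam x0 upd I 0 = []"
| "run d F gam x0 upd I (Suc t) =
     (let os = run d F gam x0 upd I t; x = (if t = 0 then x0 else upd os)
      in os @ [pifo_query d F (gam (Suc t)) (I t) x])"

definition iter :: "nat \<Rightarrow> (nat \<Rightarrow> vec \<Rightarrow> real) \<Rightarrow> (nat \<Rightarrow> real) \<Rightarrow> vec \<Rightarrow> (obs list \<Rightarrow> vec)
                 \<Rightarrow> (nat \<Rightarrow> nat) \<Rightarrow> nat \<Rightarrow> vec" where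
  "iter d F gam x0 upd I t = (if t = 0 then x0 else upd (run d F gam x0 upd I t))"

definition exp_grad_norm :: "nat \<Rightarrow> nat \<Rightarrow> (nat \<Rightarrow> vec \<Rightarrow> real) \<Rightarrow> (nat \<Rightarrow> real) \<Rightarrow> vec
      \<Rightarrow> (nat \<Rightarrow> real) \<Rightarrow> (obs list \<Rightarrow> vec) \<Rightarrow> nat \<Rightarrow> real" where
  "exp_grad_norm n d F p x0 gam upd t =
     (\<Sum>I\<in>{..<t} \<rightarrow>\<^sub>E {..<n}. (\<Prod>k<t. p (I k)) *
        nrm d (grad d (\<lambda>x. (\<Sum>i<n. F i x) / real n) (iter d F gam x0 upd I t)))"

end

theory Submission
  imports "HOL-Analysis.Convex" "HOL-Analysis.Function_Topology" Defs
begin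

text \<open>
  The hard function is a chain
  \<open>w / 2 * (b - y\<^sub>0)\<^sup>2 + \<Sum> (y\<^bsub>j-1\<^esub> - y\<^sub>j)\<^sup>2 / 2 + w\<^sup>2 * \<Sum> well b (y\<^sub>j)\<close> with \<open>w = sqrt \<alpha>\<close>.
  The separable part is shared by all components, whereas the links are given, with weight \<open>n\<close>,
  alternately to the two components that the algorithm draws least often. As \<open>0\<close> is a critical
  point of \<open>well b\<close> and no component owns two adjacent links, gradients and proximal points enlarge
  the support of an iterate by at most one coordinate, and only when one of these two components
  is drawn. This happens with probability at most \<open>3 / n\<close>, so by Markov's inequality the support
  stays below the length \<open>m\<close> of the chain with probability at least \<open>5 / 8\<close> up to time \<open>m n / 8\<close>.

  If the last coordinate of \<open>y\<close> vanishes, the gradient is large: the sequence \<open>y\<close> must come down to \<open>0\<close>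
  from the value \<open>b\<close> that the first link demands. The force of \<open>well\<close> accelerates the descent, and
  once the slope is of order \<open>w\<close>, stopping it takes \<open>N\<close> steps with a total gradient of order
  \<open>w + w\<^sup>2 N\<close>. By Cauchy--Schwarz and AM-GM the gradient norm is then of order \<open>w\<^bsup>3/2\<^esup>\<close>.
\<close>

section \<open>The one-dimensional well\<close>

definition clip :: "real \<Rightarrow> real \<Rightarrow> real" where
  "clip b t = max 0 (min t (b / 2))"

text \<open>
  A piecewise quadratic replacement for the usual nonconvex term
  \<open>120 \<integral> t\<^sup>2 (t - 1) / (1 + t\<^sup>2)\<close>: its derivative \<open>well'\<close> is \<open>- \<bar>t\<bar>\<close> up to \<open>b / 2\<close> and \<open>t - b\<close> beyond,
  so \<open>0\<close> is a degenerate critical point and \<open>b\<close> is the minimum. Writing it through the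
  projection onto \<open>[0, b / 2]\<close> reduces both curvature bounds to the projection inequality.
\<close>

definition well :: "real \<Rightarrow> real \<Rightarrow> real" where
  "well b t = t\<^sup>2 / 2 - 2 * clip b t * t + (clip b t)\<^sup>2"

definition well' :: "real \<Rightarrow> real \<Rightarrow> real" where
  "well' b t = t - 2 * clip b t"

lemma clip_bounds: "b > 0 \<Longrightarrow> 0 \<le> clip b t" "b > 0 \<Longrightarrow> clip b t \<le> b / 2"
  by (auto simp: clip_def)

lemma clip_projection:
  assumes "0 \<le> c" "c \<le> b / 2"
  shows "(t - clip b t) * (c - clip b t) \<le> 0"
  using assms by (auto simp: clip_def max_def min_def mult_le_0_iff)

text \<open>\<open>well b t + t\<^sup>2 / 2\<close> is the squared distance from \<open>t\<close> to
  \<open>[0, b / 2]\<close>, hence convex.\<close>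

lemma well_lower:
  assumes b: "b > 0"
  shows "- ((t - s)\<^sup>2 / 2) \<le> well b t - well b s - well' b s * (t - s)"
proof -
  define c e where "c = clip b t" and "e = clip b s"
  have "(s - e) * (c - e) \<le> 0"
    unfolding e_def by (rule clip_projection) (auto simp only: c_def clip_bounds b)
  moreover have "well b t - well b s - well' b s * (t - s) + (t - s)\<^sup>2 / 2 =
      (t - s - (c - e))\<^sup>2 - 2 * ((s - e) * (c - e))"
    unfolding well_def well'_def c_def[symmetric] e_def[symmetric]
    by (simp add: power2_eq_square field_simps)
  ultimately show ?thesis using zero_le_power2[of "t - s - (c - e)"] by linarith
qed

text \<open>\<open>well b t - t\<^sup>2 / 2\<close> is the minimum over \<open>c\<close> in
  \<open>[0, b / 2]\<close> of the affine functions \<open>c\<^sup>2 - 2 * c * t\<close>, attained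
  at \<open>c = clip b t\<close>; hence it is concave.\<close>

lemma well_upper:
  assumes b: "b > 0"
  shows "well b t - well b s - well' b s * (t - s) \<le> (t - s)\<^sup>2 / 2"
proof -
  define c e where "c = clip b t" and "e = clip b s"
  have "(t - c) * (e - c) \<le> 0"
    unfolding c_def by (rule clip_projection) (auto simp only: e_def clip_bounds b)
  moreover have "well b t - well b s - well' b s * (t - s) - (t - s)\<^sup>2 / 2 =
      2 * ((t - c) * (e - c)) - (e - c)\<^sup>2"
    unfolding well_def well'_def c_def[symmetric] e_def[symmetric]
    by (simp add: power2_eq_square field_simps)
  ultimately show ?thesis using zero_le_power2[of "e - c"] by linarith
qed

text \<open>Bounds the price of resetting a coordinate to \<open>0\<close>, where
  \<open>well b\<close> vanishes; needed to truncate proximal points.\<close>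

lemma well_ge_quadratic: "well b t \<ge> - (t\<^sup>2 / 2)"
proof -
  have "well b t + t\<^sup>2 / 2 = (t - clip b t)\<^sup>2"
    by (simp add: well_def power2_eq_square field_simps)
  then show ?thesis using zero_le_power2[of "t - clip b t"] by linarith
qed

lemma well_ge_const:
  assumes "b > 0" shows "well b t \<ge> - (b\<^sup>2 / 4)"
proof -
  have "well b t = (t - 2 * clip b t)\<^sup>2 / 2 - (clip b t)\<^sup>2"
    by (simp add: well_def power2_eq_square field_simps)
  moreover have "(clip b t)\<^sup>2 \<le> (b / 2)\<^sup>2" by (intro power_mono clip_bounds assms)
  moreover have "(b / 2)\<^sup>2 = b\<^sup>2 / 4" by (simp add: power_divide)
  ultimately show ?thesis using zero_le_power2[of "t - 2 * clip b t"] by linarith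
qed

lemma clip_zero [simp]: "b > 0 \<Longrightarrow> clip b 0 = 0"
  and well_zero [simp]: "b > 0 \<Longrightarrow> well b 0 = 0"
  and well'_zero [simp]: "b > 0 \<Longrightarrow> well' b 0 = 0"
  by (simp_all add: well_def well'_def clip_def)

lemma well'_scale: "b > 0 \<Longrightarrow> well' b t = b * well' 1 (t / b)"
  by (auto simp: well'_def clip_def max_def min_def field_simps)

lemma well'_eq_minus_abs: "t \<le> 1 / 2 \<Longrightarrow> well' 1 t = - \<bar>t\<bar>"
  by (auto simp: well'_def clip_def)

section \<open>Gradient of the chain at points of incomplete support\<close>

text \<open>Cauchy--Schwarz; as \<open>g\<close> vanishes from \<open>m\<close> on, the interval may
  run past \<open>m\<close>.\<close>

lemma sum_interval_squared_le:
  fixes g :: "nat \<Rightarrow> real"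
  assumes "\<And>j. j \<ge> m \<Longrightarrow> g j = 0"
  shows "(\<Sum>i = p..<q. g i)\<^sup>2 \<le> (\<Sum>i<m. (g i)\<^sup>2) * real (q - p)"
proof -
  have "(\<Sum>i = p..<q. (g i)\<^sup>2) \<le> (\<Sum>i<max m q. (g i)\<^sup>2)" by (rule sum_mono2) auto
  also have "\<dots> = (\<Sum>i<m. (g i)\<^sup>2)" by (rule sum.mono_neutral_right) (auto simp: assms)
  finally have "(\<Sum>i = p..<q. (g i)\<^sup>2) * real (q - p) \<le> (\<Sum>i<m. (g i)\<^sup>2) * real (q - p)"
    by (intro mult_right_mono) auto
  then show ?thesis using sum_squared_le_sum_of_squares[of g "{p..<q}"] by simp
qed

text \<open>A sequence decreasing in steps of at least \<open>\<delta>\<close> spends little time near \<open>0\<close>; the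
  clamped value serves as a telescoping potential.\<close>

lemma sum_abs_decreasing_ge:
  fixes z :: "nat \<Rightarrow> real"
  assumes d: "\<delta> > 0" and b: "b > 0" and step: "\<And>i. k \<le> i \<Longrightarrow> Suc i < j \<Longrightarrow> z (Suc i) \<le> z i - \<delta>"
    and kj: "k < j"
  shows "(\<Sum>i = k..<j. \<bar>z i\<bar>) \<ge> b * real (j - k) - (2 * b\<^sup>2 / \<delta> + 2 * b)"
proof -
  \<comment> \<open>The lower clamp is \<open>- b - \<delta>\<close> instead of \<open>- b\<close>,
    so that a step starting strictly between \<open>- b\<close> and \<open>b\<close> still loses the
    full \<open>\<delta>\<close> after clamping.\<close>
  define Q where "Q = (\<lambda>x. max (- b - \<delta>) (min x b))"
  have pt: "b - \<bar>x\<bar> \<le> b / \<delta> * (Q x - Q x')" if "x' \<le> x - \<delta>" for x x'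
  proof (cases "\<bar>x\<bar> < b")
    case True
    then have "Q x - Q x' \<ge> \<delta>" using that d b by (auto simp: Q_def max_def min_def)
    then have "b / \<delta> * \<delta> \<le> b / \<delta> * (Q x - Q x')" using b d by (intro mult_left_mono) auto
    then show ?thesis using d by simp
  next
    case False
    have "Q x' \<le> Q x" using that d by (auto simp: Q_def max_def min_def)
    then have "0 \<le> b / \<delta> * (Q x - Q x')" using b d by (intro mult_nonneg_nonneg) auto
    then show ?thesis using False by linarith
  qed
  have "(\<Sum>i = k..<l. b - \<bar>z i\<bar>) \<le> b / \<delta> * (Q (z k) - Q (z l))" if "k \<le> l" "l < j" for l
    using that
  proof (induction l rule: dec_induct)
    case (step l)
    then have "b - \<bar>z l\<bar> \<le> b / \<delta> * (Q (z l) - Q (z (Suc l)))" by (intro pt assms(3)) auto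
    then show ?case using step by (simp add: algebra_simps)
  qed auto
  \<comment> \<open>No step is assumed from the last index \<open>j - 1\<close>; its term is split
    off and bounded by \<open>b\<close>.\<close>
  from this[of "j - 1"] kj have "(\<Sum>i = k..<j - 1. b - \<bar>z i\<bar>) \<le> b / \<delta> * (Q (z k) - Q (z (j - 1)))"
    by auto
  also have "\<dots> \<le> b / \<delta> * (2 * b + \<delta>)"
    using b d by (intro mult_left_mono) (auto simp: Q_def)
  also have "\<dots> = 2 * b\<^sup>2 / \<delta> + b" using d by (simp add: field_simps power2_eq_square)
  finally have "(\<Sum>i = k..<j - 1. b - \<bar>z i\<bar>) \<le> 2 * b\<^sup>2 / \<delta> + b" .
  moreover have "(\<Sum>i = k..<j. b - \<bar>z i\<bar>) = (\<Sum>i = k..<j - 1. b - \<bar>z i\<bar>) + (b - \<bar>z (j - 1)\<bar>)"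
    using kj by (cases j) auto
  ultimately have "(\<Sum>i = k..<j. b - \<bar>z i\<bar>) \<le> 2 * b\<^sup>2 / \<delta> + 2 * b" by linarith
  then show ?thesis by (simp add: sum_subtractf mult.commute)
qed

lemma slope_recursion:
  fixes D y g :: "nat \<Rightarrow> real"
  assumes "\<And>j. D (Suc j) = D j + g j - v * h (y j)" and "k \<le> j"
  shows "D j = D k + (\<Sum>i = k..<j. g i) - v * (\<Sum>i = k..<j. h (y i))"
  using \<open>k \<le> j\<close>
proof (induction j rule: dec_induct)
  case (step j)
  then show ?case using assms(1)[of j] by (simp add: algebra_simps)
qed simp

text \<open>Read \<open>y\<close> as a position, \<open>D\<close> as its downward velocity and
  \<open>g\<close> as an external force. Below \<open>1 / 2\<close> the well only accelerates the
  descent, yet \<open>D\<close> must vanish in the end, so \<open>g\<close> has to do all the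
  braking.\<close>

lemma steep_descent_gradient:
  fixes D y g :: "nat \<Rightarrow> real"
  assumes w: "0 < w" "w \<le> 1"
    and rec: "\<And>j. D (Suc j) = D j + g j - w\<^sup>2 * well' 1 (y j)"
    and step: "\<And>j. y (Suc j) = y j - D (Suc j)"
    and gz: "\<And>j. j \<ge> m \<Longrightarrow> g j = 0"
    and Dz: "\<And>j. j \<ge> m \<Longrightarrow> D j = 0"
    and k: "D k \<ge> w / 8" "y k \<le> 1 / 2"
  shows "(\<Sum>i<m. (g i)\<^sup>2) \<ge> w ^ 3 / 729"
proof -
  \<comment> \<open>\<open>j\<close> is the first time after \<open>k\<close> at which the slope is
    down to half of \<open>w / 8\<close>; until then \<open>y\<close> falls by more than
    \<open>w / 16\<close> per step.\<close>
  define P where "P = (\<lambda>j. j > k \<and> D j \<le> w / 16)"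
  define j where "j = (LEAST j. P j)"
  have "P (Suc (max k m))" using Dz w by (simp add: P_def)
  then have Pj: "P j" unfolding j_def by (rule LeastI)
  have big: "D i > w / 16" if "k \<le> i" "i < j" for i
  proof (cases "i = k")
    case False
    then have "\<not> P i" using not_less_Least that unfolding j_def by blast
    then show ?thesis using False that by (auto simp: P_def)
  qed (use k w in auto)
  have kj: "k < j" and Dj: "D j \<le> w / 16" using Pj by (auto simp: P_def)
  have small: "y i \<le> 1 / 2" if "k \<le> i" "i < j" for i
    using that
  proof (induction i rule: dec_induct)
    case (step i)
    then show ?case using big[of "Suc i"] assms(4)[of i] w by auto
  qed (use k in auto)
  have N: "real (j - k) > 0" using kj by simp
  define A where "A = (\<Sum>i = k..<j. \<bar>y i\<bar>)"
  \<comment> \<open>At level \<open>1 / 64\<close> the loss is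
    \<open>w / 128 + w\<^sup>2 / 32\<close> after scaling by \<open>w\<^sup>2\<close>, which stays
    below the slope drop of at least \<open>w / 16\<close> by a margin of
    \<open>3 * w / 128\<close>.\<close>
  have "A \<ge> 1/64 * real (j - k) - (2 * (1/64)\<^sup>2 / (w / 16) + 2 * (1/64))"
    unfolding A_def by (rule sum_abs_decreasing_ge) (use w kj step big in \<open>auto simp: less_imp_le\<close>)
  then have "w\<^sup>2 * A \<ge> w\<^sup>2 * (1/64 * real (j - k) - (2 * (1/64)\<^sup>2 / (w / 16) + 2 * (1/64)))"
    by (intro mult_left_mono) auto
  also have "w\<^sup>2 * (1/64 * real (j - k) - (2 * (1/64)\<^sup>2 / (w / 16) + 2 * (1/64)))
     = w\<^sup>2 * real (j - k) / 64 - w / 128 - w\<^sup>2 / 32"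
    using w by (simp add: field_simps power2_eq_square)
  finally have A: "w\<^sup>2 * A \<ge> w\<^sup>2 * real (j - k) / 64 - w / 128 - w\<^sup>2 / 32" .
  have ww: "w\<^sup>2 \<le> w" using w by (simp add: power2_eq_square mult_left_le)
  have "(\<Sum>i = k..<j. well' 1 (y i)) = - A"
    unfolding A_def sum_negf[symmetric] by (rule sum.cong) (use small well'_eq_minus_abs in auto)
  then have "D j = D k + (\<Sum>i = k..<j. g i) + w\<^sup>2 * A"
    using slope_recursion[of D g "w\<^sup>2" "well' 1" y, OF rec, of k j] kj by simp
  then have S: "- (\<Sum>i = k..<j. g i) \<ge> 3 * w / 128 + w\<^sup>2 * real (j - k) / 64"
    using A Dj k ww by linarith
  \<comment> \<open>By AM-GM the left side carries the factor \<open>j - k\<close> that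
    Cauchy--Schwarz produces on the right, so the braking time cancels.\<close>
  have "4 * (3 * w / 128) * (w\<^sup>2 * real (j - k) / 64) \<le> (3 * w / 128 + w\<^sup>2 * real (j - k) / 64)\<^sup>2"
    using zero_le_power2[of "3 * w / 128 - w\<^sup>2 * real (j - k) / 64"]
    by (simp add: power2_eq_square algebra_simps)
  also have "\<dots> \<le> (- (\<Sum>i = k..<j. g i))\<^sup>2"
    using S w by (intro power_mono) auto
  also have "\<dots> \<le> (\<Sum>i<m. (g i)\<^sup>2) * real (j - k)"
    using sum_interval_squared_le[OF gz] by simp
  finally have "(12 / 8192 * w ^ 3) * real (j - k) \<le> (\<Sum>i<m. (g i)\<^sup>2) * real (j - k)"
    by (simp add: power3_eq_cube power2_eq_square algebra_simps)
  then have "12 / 8192 * w ^ 3 \<le> (\<Sum>i<m. (g i)\<^sup>2)" using N by simp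
  moreover have "w ^ 3 > 0" using w by simp
  ultimately show ?thesis by linarith
qed

text \<open>Either the slope is at least \<open>w / 8\<close> somewhere at level
  \<open>1 / 2\<close> or lower, and the braking estimate applies, or \<open>y\<close> lingers
  between \<open>1 / 4\<close> and \<open>1 / 2\<close> so long that \<open>g\<close> must have
  cancelled the force of the well.\<close>

lemma chain_gradient_lower_bound:
  fixes y g D :: "nat \<Rightarrow> real"
  assumes w: "0 < w" "w \<le> 1"
    and y0: "\<And>j. j \<ge> M \<Longrightarrow> y j = 0" and Mm: "M < m"
    and D0: "D 0 = w * (1 - y 0)" and step: "\<And>j. D (Suc j) = y j - y (Suc j)"
    and g: "\<And>j. g j = D (Suc j) - D j + w\<^sup>2 * well' 1 (y j)"
  shows "(\<Sum>i<m. (g i)\<^sup>2) \<ge> w ^ 3 / 729"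
proof -
  have Dz: "D j = 0" if "j \<ge> m" for j
    using that Mm step[of "j - 1"] y0[of j] y0[of "j - 1"] by auto
  have gz: "g j = 0" if "j \<ge> m" for j
    using that Mm Dz[of j] Dz[of "Suc j"] y0[of j] by (simp add: g)
  have rec: "D (Suc j) = D j + g j - w\<^sup>2 * well' 1 (y j)" for j by (simp add: g)
  have step': "y (Suc j) = y j - D (Suc j)" for j by (simp add: step)
  note steep = steep_descent_gradient[of w D g y m, OF w rec step' gz Dz]
  show ?thesis
  proof (cases "y 0 \<le> 1 / 2")
    case True
    then have "w * (1 - y 0) \<ge> w * (1 / 8)" using w by (intro mult_left_mono) auto
    then show ?thesis using steep[of 0] True D0 by simp
  next
    case False
    define k where "k = (GREATEST k. y k > 1 / 2)"
    have bd: "\<forall>i. y i > 1/2 \<longrightarrow> i \<le> M" 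
    proof (intro allI impI)
      fix i assume "y i > 1 / 2"
      then have "y i \<noteq> 0" by auto
      then show "i \<le> M" using y0[of i] by linarith
    qed
    have yk: "y k > 1 / 2"
      unfolding k_def by (rule GreatestI_nat[where k = 0 and b = M]) (use False bd in auto)
    have after: "y i \<le> 1 / 2" if "i > k" for i
      using Greatest_le_nat[of "\<lambda>k. y k > 1/2" i M] bd that unfolding k_def by force
    show ?thesis
    proof (cases "\<exists>i>k. D i \<ge> w / 8")
      case True
      then show ?thesis using steep after by blast
    next
      case False
      then have slow: "D i < w / 8" if "i > k" for i using that by force
      have yr: "y (k + r) > 1 / 2 - real r * (w / 8)" if "r > 0" for r
        using that
      proof (induction r rule: nat_induct_non_zero)
        case 1
        then show ?case using slow[of "Suc k"] step[of k] yk by simp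
      next
        case (Suc r)
        have "real (Suc r) * (w / 8) = real r * (w / 8) + w / 8" by (simp add: algebra_simps)
        moreover have "D (Suc (k + r)) < w / 8" by (rule slow) simp
        ultimately have "1 / 2 - real (Suc r) * (w / 8) < y (Suc (k + r))"
          using Suc step[of "k + r"] by linarith
        then show ?case by simp
      qed
      \<comment> \<open>In \<open>2 / w\<close> steps, slopes below \<open>w / 8\<close> lower
        \<open>y\<close> by at most \<open>1 / 4\<close>, whereas the well alone would raise the
        slope by at least \<open>w / 4\<close>.\<close>
      define R where "R = nat \<lfloor>2 / w\<rfloor>"
      have R: "real R \<le> 2 / w" "real R \<ge> 2 / w - 1" using w by (auto simp: R_def)
      have Rw: "real R * w \<le> 2" "real R * w \<ge> 2 - w" 
        using R w by (auto simp: field_simps)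
      have A: "- well' 1 (y i) \<ge> 1 / 4" if "i \<in> {Suc k..<Suc k + R}" for i
      proof -
        define r where "r = i - k"
        have r: "i = k + r" "0 < r" "r \<le> R" using that by (auto simp: r_def)
        have "real r * w \<le> real R * w" using r w by (intro mult_right_mono) auto
        then have "real r * (w / 8) \<le> 1 / 4" using Rw by linarith
        then have "y i > 1 / 4" using yr[OF r(2)] unfolding r(1) by linarith
        then show ?thesis using after[of i] r by (simp add: well'_eq_minus_abs)
      qed
      have "(\<Sum>i = Suc k..<Suc k + R. - well' 1 (y i)) \<ge> real (card {Suc k..<Suc k + R}) * (1 / 4)"
        by (rule sum_bounded_below) (rule A)
      then have "- (\<Sum>i = Suc k..<Suc k + R. well' 1 (y i)) \<ge> real R / 4" by (simp add: sum_negf)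
      then have "w\<^sup>2 * (real R / 4) \<le> w\<^sup>2 * - (\<Sum>i = Suc k..<Suc k + R. well' 1 (y i))" by (intro mult_left_mono) auto
      moreover have "w\<^sup>2 * (real R / 4) \<ge> w / 4"
      proof -
        have "w * (real R * w) \<ge> w * 1" using Rw w by (intro mult_left_mono) auto
        then show ?thesis by (simp add: power2_eq_square algebra_simps)
      qed
      moreover have "D (Suc k + R) = D (Suc k) + (\<Sum>i = Suc k..<Suc k + R. g i) - w\<^sup>2 * (\<Sum>i = Suc k..<Suc k + R. well' 1 (y i))"
        by (rule slope_recursion[of D g "w\<^sup>2" "well' 1" y, OF rec]) auto
      moreover have "D (Suc k) > 0" using step[of k] yk after[of "Suc k"] by simp
      moreover have "D (Suc k + R) < w / 8" by (rule slow) simp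
      ultimately have "- (\<Sum>i = Suc k..<Suc k + R. g i) \<ge> w / 8" by linarith
      then have "(w / 8)\<^sup>2 \<le> (- (\<Sum>i = Suc k..<Suc k + R. g i))\<^sup>2" using w by (intro power_mono) auto
      also have "\<dots> \<le> (\<Sum>i<m. (g i)\<^sup>2) * real R"
        using sum_interval_squared_le[of m g "Suc k" "Suc k + R", OF gz] by simp
      also have "\<dots> \<le> (\<Sum>i<m. (g i)\<^sup>2) * (2 / w)" using R by (intro mult_left_mono sum_nonneg) auto
      finally have "w ^ 3 / 128 \<le> (\<Sum>i<m. (g i)\<^sup>2)" using w by (simp add: field_simps power2_eq_square power3_eq_cube)
      moreover have "w ^ 3 > 0" using w by simp
      ultimately show ?thesis by linarith
    qed
  qed
qed

section \<open>Quadratic bounds, gradients and proximal points\<close>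

lemma vsub_in_vsp: "x \<in> vsp d \<Longrightarrow> y \<in> vsp d \<Longrightarrow> vsub x y \<in> vsp d"
  by (simp add: vsp_def vsub_def)

lemma ip_commute: "ip d x y = ip d y x"
  by (simp add: ip_def mult.commute)

lemma ip_self_nonneg: "ip d x x \<ge> 0"
  by (auto simp: ip_def intro: sum_nonneg)

lemma nrm_nonneg: "nrm d x \<ge> 0"
  by (simp add: nrm_def ip_self_nonneg)

lemma nrm_squared: "(nrm d x)\<^sup>2 = ip d x x"
  by (simp add: nrm_def ip_self_nonneg)

lemma ip_scale_left: "ip d (\<lambda>j. a * x j) y = a * ip d x y"
  by (simp add: ip_def sum_distrib_left mult.assoc)

lemma ip_scale_right: "ip d x (\<lambda>j. a * y j) = a * ip d x y"
  by (simp add: ip_def sum_distrib_left mult_ac)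

lemma ip_vsub_left: "ip d (vsub x z) y = ip d x y - ip d z y"
  by (simp add: ip_def vsub_def sum_subtractf algebra_simps)

lemma ip_vsub_right: "ip d x (vsub y z) = ip d x y - ip d x z"
  by (simp add: ip_def vsub_def sum_subtractf algebra_simps)

lemma ip_self_eq_0: "x \<in> vsp d \<Longrightarrow> ip d x x = 0 \<longleftrightarrow> x = (\<lambda>_. 0)"
  by (subst ip_def, subst sum_nonneg_eq_0_iff) (auto simp: vsp_def fun_eq_iff not_less[symmetric])

lemma vsub_eq_zero: "vsub x y = (\<lambda>_. 0) \<longleftrightarrow> x = y"
  by (auto simp: vsub_def fun_eq_iff)

lemma has_grad_unique:
  assumes "has_grad d g G x" "has_grad d g G' x"
  shows "G = G'"
proof (rule ccontr)
  assume ne: "G \<noteq> G'"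
  define E where "E = vsub G G'"
  define N where "N = nrm d E"
  have E: "E \<in> vsp d" using assms by (auto simp: E_def has_grad_def vsub_in_vsp)
  have N2: "N\<^sup>2 = ip d E E" by (simp add: N_def nrm_squared)
  have "N\<^sup>2 \<noteq> 0" using ip_self_eq_0[OF E] ne vsub_eq_zero N2 by (auto simp: E_def)
  then have N: "N > 0" using nrm_nonneg[of d E] by (simp add: N_def)
  have e: "N / 4 > 0" using N by simp
  obtain r1 where r1: "r1 > 0" "\<forall>h\<in>vsp d. nrm d h < r1 \<longrightarrow> \<bar>g (vadd x h) - g x - ip d G h\<bar> \<le> N / 4 * nrm d h"
    using assms(1) e unfolding has_grad_def by blast
  obtain r2 where r2: "r2 > 0" "\<forall>h\<in>vsp d. nrm d h < r2 \<longrightarrow> \<bar>g (vadd x h) - g x - ip d G' h\<bar> \<le> N / 4 * nrm d h"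
    using assms(2) e unfolding has_grad_def by blast
  \<comment> \<open>The test vector is the multiple of \<open>G - G'\<close> whose length is half
    the smaller radius. There the linear parts differ by \<open>s * N\<^sup>2\<close>, twice what
    the two errors allow.\<close>
  define s where "s = min r1 r2 / (2 * N)"
  have s: "s > 0" using r1 r2 N by (simp add: s_def)
  define h where "h = (\<lambda>j. s * E j)"
  have "nrm d h = sqrt (s\<^sup>2 * N\<^sup>2)"
    unfolding nrm_def h_def ip_scale_left ip_scale_right N2 by (simp add: power2_eq_square mult.assoc)
  then have nh: "nrm d h = s * N" using s N by (simp add: real_sqrt_mult)
  have sN: "s * N = min r1 r2 / 2" using N by (simp add: s_def field_simps)
  then have "s * N < r1" "s * N < r2" using r1 r2 by auto
  moreover have "h \<in> vsp d" using E by (auto simp: h_def vsp_def)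
  ultimately have "\<bar>g (vadd x h) - g x - ip d G h\<bar> \<le> N / 4 * (s * N)" "\<bar>g (vadd x h) - g x - ip d G' h\<bar> \<le> N / 4 * (s * N)"
    using r1 r2 by (auto simp: nh)
  then have "\<bar>ip d G h - ip d G' h\<bar> \<le> N / 2 * (s * N)" by linarith
  moreover have "ip d G h - ip d G' h = s * N\<^sup>2"
    by (simp add: h_def ip_scale_right N2 E_def ip_vsub_left ip_vsub_right algebra_simps)
  ultimately have "s * N\<^sup>2 \<le> (s * N\<^sup>2) / 2" using s by (simp add: power2_eq_square mult_ac)
  then show False using s N by simp
qed

text \<open>Smoothness with the gradient as explicit data. The inequalities determine
  \<open>G\<close> on \<open>vsp d\<close>, and averaging or reflecting them never meets the
  definite description in \<open>grad\<close>.\<close>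

definition quad_bounds :: "nat \<Rightarrow> real \<Rightarrow> real \<Rightarrow> (vec \<Rightarrow> real) \<Rightarrow> (vec \<Rightarrow> vec) \<Rightarrow> bool" where
  "quad_bounds d l L g G \<longleftrightarrow> (\<forall>y\<in>vsp d. G y \<in> vsp d) \<and>
     (\<forall>x\<in>vsp d. \<forall>y\<in>vsp d.
        l / 2 * ip d (vsub x y) (vsub x y) \<le> g x - g y - ip d (G y) (vsub x y) \<and>
        g x - g y - ip d (G y) (vsub x y) \<le> L / 2 * ip d (vsub x y) (vsub x y))"

lemma quad_bounds_has_grad:
  assumes q: "quad_bounds d l L g G" and y: "y \<in> vsp d"
  shows "has_grad d g (G y) y"
proof -
  \<comment> \<open>\<open>B\<close> dominates both curvature bounds, so the remainder is quadratic
    in the norm of \<open>h\<close>; the \<open>1\<close> keeps \<open>B\<close> positive.\<close>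
  define B where "B = max 1 (max (- l / 2) (L / 2))"
  have B: "B > 0" "- l / 2 \<le> B" "L / 2 \<le> B" by (auto simp: B_def)
  have key: "\<bar>g (vadd y h) - g y - ip d (G y) h\<bar> \<le> e * nrm d h"
    if e: "e > 0" and h: "h \<in> vsp d" and s: "nrm d h < e / B" for e h
  proof -
    have "vadd y h \<in> vsp d" using y h by (auto simp: vadd_def vsp_def)
    moreover have "vsub (vadd y h) y = h" by (auto simp: vsub_def vadd_def)
    ultimately have q': "l / 2 * ip d h h \<le> g (vadd y h) - g y - ip d (G y) h"
       "g (vadd y h) - g y - ip d (G y) h \<le> L / 2 * ip d h h"
      using q y unfolding quad_bounds_def by metis+
    have "- l / 2 * ip d h h \<le> B * ip d h h" "L / 2 * ip d h h \<le> B * ip d h h"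
      by (rule mult_right_mono[OF B(2) ip_self_nonneg], rule mult_right_mono[OF B(3) ip_self_nonneg])
    then have "\<bar>g (vadd y h) - g y - ip d (G y) h\<bar> \<le> B * ip d h h" using q' by (auto simp: abs_le_iff)
    also have "\<dots> = B * nrm d h * nrm d h" by (simp add: nrm_squared[symmetric] power2_eq_square)
    also have "\<dots> \<le> e * nrm d h" using s B by (intro mult_right_mono nrm_nonneg) (simp add: field_simps)
    finally show ?thesis .
  qed
  have "G y \<in> vsp d" using q y by (auto simp: quad_bounds_def)
  moreover have "e / B > 0" if "e > 0" for e using that B by simp
  ultimately show ?thesis unfolding has_grad_def using key by metis
qed

lemma quad_bounds_grad:
  assumes "quad_bounds d l L g G" "y \<in> vsp d"
  shows "grad d g y = G y"
  unfolding grad_def using quad_bounds_has_grad[OF assms] has_grad_unique by blast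

lemma quad_bounds_smooth:
  assumes "quad_bounds d l L g G"
  shows "smooth d l L g"
  using assms quad_bounds_has_grad[OF assms]
  by (auto simp: smooth_def differentiable_vsp_def nrm_squared quad_bounds_grad[OF assms] quad_bounds_def)

lemma quad_bounds_average:
  assumes q: "\<And>i. i < n \<Longrightarrow> quad_bounds d l L (F i) (G i)" and n: "n > 0"
  shows "quad_bounds d l L (\<lambda>x. (\<Sum>i<n. F i x) / real n) (\<lambda>y j. (\<Sum>i<n. G i y j) / real n)"
  unfolding quad_bounds_def
proof (intro conjI ballI)
  fix y assume y: "y \<in> vsp d"
  show "(\<lambda>j. (\<Sum>i<n. G i y j) / real n) \<in> vsp d"
    using q y by (auto simp: vsp_def quad_bounds_def)
next
  fix x y assume x: "x \<in> vsp d" and y: "y \<in> vsp d"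
  define h where "h = vsub x y"
  define R where "R = (\<lambda>i. F i x - F i y - ip d (G i y) h)"
  have "ip d (\<lambda>j. (\<Sum>i<n. G i y j) / real n) h = (\<Sum>i<n. ip d (G i y) h) / real n"
    unfolding ip_def sum_divide_distrib sum_distrib_right times_divide_eq_left 
    by (subst sum.swap) simp
  then have eq: "(\<Sum>i<n. F i x) / real n - (\<Sum>i<n. F i y) / real n - ip d (\<lambda>j. (\<Sum>i<n. G i y j) / real n) h
     = (\<Sum>i<n. R i) / real n"
    by (simp add: R_def sum_subtractf diff_divide_distrib)
  have R: "l / 2 * ip d h h \<le> R i" "R i \<le> L / 2 * ip d h h" if "i < n" for i
    using q[OF that] x y unfolding quad_bounds_def R_def h_def by blast+
  have "(\<Sum>i<n. R i) \<ge> real (card {..<n}) * (l / 2 * ip d h h)" by (rule sum_bounded_below) (use R in auto)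
  then show "l / 2 * ip d (vsub x y) (vsub x y) \<le> (\<Sum>i<n. F i x) / real n - (\<Sum>i<n. F i y) / real n - ip d (\<lambda>j. (\<Sum>i<n. G i y j) / real n) (vsub x y)"
    unfolding h_def[symmetric] eq using n by (simp add: field_simps)
  have "(\<Sum>i<n. R i) \<le> real (card {..<n}) * (L / 2 * ip d h h)" by (rule sum_bounded_above) (use R in auto)
  then show "(\<Sum>i<n. F i x) / real n - (\<Sum>i<n. F i y) / real n - ip d (\<lambda>j. (\<Sum>i<n. G i y j) / real n) (vsub x y) \<le> L / 2 * ip d (vsub x y) (vsub x y)"
    unfolding h_def[symmetric] eq using n by (simp add: field_simps)
qed

section \<open>Existence and uniqueness of proximal points\<close>

definition prox_min :: "nat \<Rightarrow> real \<Rightarrow> (vec \<Rightarrow> real) \<Rightarrow> vec \<Rightarrow> vec \<Rightarrow> bool" where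
  "prox_min d \<gamma> g x u \<longleftrightarrow> u \<in> vsp d \<and>
     (\<forall>v\<in>vsp d. g u + 1 / (2 * \<gamma>) * (nrm d (vsub x u))\<^sup>2
                 \<le> g v + 1 / (2 * \<gamma>) * (nrm d (vsub x v))\<^sup>2)"

text \<open>Strong convexity tested at the midpoint \<open>z\<close>: the gradient terms cancel, and
  the parallelogram identity leaves a gap of \<open>1 / \<gamma> - \<sigma>\<close> times a quarter
  of the squared distance.\<close>

lemma prox_min_unique:
  assumes q: "quad_bounds d (- \<sigma>) L g G" and \<gamma>: "1 / \<gamma> > \<sigma>"
    and u: "prox_min d \<gamma> g x u" and v: "prox_min d \<gamma> g x v"
  shows "u = v"
proof -
  define z where "z = (\<lambda>j. (u j + v j) / 2)"
  define h where "h = vsub u v"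
  have uv: "u \<in> vsp d" "v \<in> vsp d" and z: "z \<in> vsp d"
    using u v by (auto simp: prox_min_def z_def vsp_def)
  have h1: "vsub u z = (\<lambda>j. 1/2 * h j)" and h2: "vsub v z = (\<lambda>j. -(1/2) * h j)"
    by (auto simp: vsub_def z_def h_def fun_eq_iff field_simps)
  have a: "- \<sigma> / 2 * ip d (vsub u z) (vsub u z) \<le> g u - g z - ip d (G z) (vsub u z)"
    and b: "- \<sigma> / 2 * ip d (vsub v z) (vsub v z) \<le> g v - g z - ip d (G z) (vsub v z)"
    using q uv z by (auto simp: quad_bounds_def)
  have "- \<sigma> / 4 * ip d h h \<le> g u + g v - 2 * g z"
    using a b unfolding h1 h2 ip_scale_left ip_scale_right by (simp add: algebra_simps)
  moreover have "ip d (vsub x u) (vsub x u) + ip d (vsub x v) (vsub x v) = 2 * ip d (vsub x z) (vsub x z) + ip d h h / 2"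
    unfolding ip_def sum.distrib[symmetric] sum_distrib_left sum_divide_distrib
    by (rule sum.cong) (auto simp: vsub_def z_def h_def power2_eq_square field_simps)
  then have "1 / (2 * \<gamma>) * (ip d (vsub x u) (vsub x u) + ip d (vsub x v) (vsub x v)) 
     = 1 / (2 * \<gamma>) * (2 * ip d (vsub x z) (vsub x z)) + 1 / \<gamma> * (ip d h h / 4)" by (simp add: algebra_simps)
  moreover have "g u + 1 / (2 * \<gamma>) * ip d (vsub x u) (vsub x u) \<le> g z + 1 / (2 * \<gamma>) * ip d (vsub x z) (vsub x z)"
    "g v + 1 / (2 * \<gamma>) * ip d (vsub x v) (vsub x v) \<le> g z + 1 / (2 * \<gamma>) * ip d (vsub x z) (vsub x z)"
    using u v z by (auto simp: prox_min_def nrm_squared)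
  ultimately have "(1 / \<gamma> - \<sigma>) * (ip d h h / 4) \<le> 0" by (simp add: algebra_simps)
  then have "ip d h h \<le> 0" using \<gamma> by (simp add: mult_le_0_iff)
  then have "ip d h h = 0" using ip_self_nonneg[of d h] by linarith
  then show ?thesis using ip_self_eq_0[of h d] vsub_in_vsp uv vsub_eq_zero by (auto simp: h_def)
qed

lemma continuous_on_coordinate: "continuous_on S (\<lambda>x::nat \<Rightarrow> real. x i)"
  by (rule continuous_on_subset[OF continuous_on_product_coordinates]) simp

text \<open>Around \<open>y\<close> the function is squeezed between two quadratics that tend to
  \<open>g y\<close>; convergence is coordinatewise.\<close>

lemma quad_bounds_continuous:
  assumes q: "quad_bounds d l L g G"
  shows "continuous_on (vsp d) g"
  unfolding continuous_on_def
proof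
  fix y assume y: "y \<in> vsp d"
  let ?F = "at y within vsp d"
  have coord: "((\<lambda>x. x i) \<longlongrightarrow> y i) ?F" for i
    using continuous_on_coordinate[of "vsp d" i] y by (simp add: continuous_on_def)
  have lim: "((\<lambda>x. g y + ip d (G y) (vsub x y) + a / 2 * ip d (vsub x y) (vsub x y)) \<longlongrightarrow> g y) ?F" for a
  proof -
    have "((\<lambda>x. g y + ip d (G y) (vsub x y) + a / 2 * ip d (vsub x y) (vsub x y)) \<longlongrightarrow> 
       g y + ip d (G y) (vsub y y) + a / 2 * ip d (vsub y y) (vsub y y)) ?F"
      unfolding ip_def vsub_def by (intro tendsto_intros coord)
    then show ?thesis by (simp add: vsub_def ip_def)
  qed
  have ev: "\<forall>\<^sub>F x in ?F. x \<in> vsp d" by (simp add: eventually_at_filter)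
  show "(g \<longlongrightarrow> g y) ?F"
  proof (rule tendsto_sandwich[OF _ _ lim[of l] lim[of L]]; rule eventually_mono[OF ev])
    fix x assume "x \<in> vsp d"
    then have "l / 2 * ip d (vsub x y) (vsub x y) \<le> g x - g y - ip d (G y) (vsub x y)"
        "g x - g y - ip d (G y) (vsub x y) \<le> L / 2 * ip d (vsub x y) (vsub x y)"
      using q y by (auto simp: quad_bounds_def)
    then show "g y + ip d (G y) (vsub x y) + l / 2 * ip d (vsub x y) (vsub x y) \<le> g x"
      "g x \<le> g y + ip d (G y) (vsub x y) + L / 2 * ip d (vsub x y) (vsub x y)" by linarith+
  qed
qed

text \<open>Tychonoff's theorem for a product over all of \<open>nat\<close>, with the factor
  \<open>{0}\<close> at the coordinates from \<open>d\<close> on.\<close>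

lemma compact_box: "compact {u \<in> vsp d. \<forall>i<d. \<bar>u i - x i\<bar> \<le> R}"
proof -
  define S where "S = (\<lambda>i. if i < d then {x i - R .. x i + R} else {0::real})"
  have "compactin (product_topology (\<lambda>i::nat. euclidean) UNIV) (PiE UNIV S)"
    unfolding compactin_PiE by (auto simp: S_def)
  then have "compact (PiE UNIV S)" by (simp add: euclidean_product_topology)
  also have "PiE UNIV S = {u \<in> vsp d. \<forall>i<d. \<bar>u i - x i\<bar> \<le> R}"
  proof (intro set_eqI)
    fix u
    have "u \<in> PiE UNIV S \<longleftrightarrow> (\<forall>i. u i \<in> S i)" by auto
    also have "\<dots> \<longleftrightarrow> (\<forall>i. (i < d \<longrightarrow> \<bar>u i - x i\<bar> \<le> R) \<and> (i \<ge> d \<longrightarrow> u i = 0))"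
      by (rule all_cong1) (auto simp: S_def abs_le_iff)
    also have "\<dots> \<longleftrightarrow> u \<in> {u \<in> vsp d. \<forall>i<d. \<bar>u i - x i\<bar> \<le> R}" by (auto simp: vsp_def)
    finally show "u \<in> PiE UNIV S \<longleftrightarrow> u \<in> {u \<in> vsp d. \<forall>i<d. \<bar>u i - x i\<bar> \<le> R}" .
  qed
  finally show ?thesis .
qed

lemma prox_min_exists:
  assumes q: "quad_bounds d (- \<sigma>) L g G" and \<gamma>: "1 / \<gamma> > \<sigma>" and x: "x \<in> vsp d"
  shows "\<exists>u. prox_min d \<gamma> g x u"
proof -
  define \<Phi> where "\<Phi> = (\<lambda>u. g u + 1 / (2 * \<gamma>) * (nrm d (vsub x u))\<^sup>2)"
  define c where "c = (1 / \<gamma> - \<sigma>) / 2"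
  have c: "c > 0" using \<gamma> by (simp add: c_def)
  \<comment> \<open>At distance more than \<open>R\<close> from \<open>x\<close> the growth
    \<open>c * N\<^sup>2\<close> beats the linear term, so points outside the box are no better than
    \<open>x\<close>.\<close>
  define R where "R = nrm d (G x) / c"
  have R0: "R \<ge> 0" using c by (simp add: R_def nrm_nonneg)
  define S where "S = {u \<in> vsp d. \<forall>i<d. \<bar>u i - x i\<bar> \<le> R}"
  have xS: "x \<in> S" using x R0 by (simp add: S_def)
  have "continuous_on (vsp d) \<Phi>"
    unfolding \<Phi>_def nrm_squared ip_def vsub_def
    by (intro continuous_intros quad_bounds_continuous[OF q] continuous_on_coordinate)
  then have "continuous_on S \<Phi>" by (rule continuous_on_subset) (auto simp: S_def)
  then obtain u where u: "u \<in> S" "\<And>v. v \<in> S \<Longrightarrow> \<Phi> u \<le> \<Phi> v"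
    using continuous_attains_inf[of S \<Phi>] compact_box[of d x R] xS unfolding S_def by blast
  have out: "\<Phi> x \<le> \<Phi> v" if v: "v \<in> vsp d" "v \<notin> S" for v
  proof -
    define h where "h = vsub v x"
    define N where "N = nrm d h"
    obtain i where i: "i < d" "\<bar>v i - x i\<bar> > R" using v by (force simp: S_def)
    have "(v i - x i)\<^sup>2 \<le> (\<Sum>i<d. (v i - x i)\<^sup>2)" using i by (intro member_le_sum) auto
    also have "\<dots> = N\<^sup>2" unfolding N_def nrm_squared ip_def h_def vsub_def by (simp add: power2_eq_square)
    finally have "\<bar>v i - x i\<bar> \<le> N" using nrm_nonneg[of d h] by (simp add: N_def abs_le_square_iff[symmetric])
    then have NR: "N > R" using i by simp
    have cs: "\<bar>ip d (G x) h\<bar> \<le> nrm d (G x) * N"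
    proof -
      have "(ip d (G x) h)\<^sup>2 \<le> (nrm d (G x) * N)\<^sup>2"
        using Cauchy_Schwarz_ineq_sum[of "G x" h "{..<d}"]
        unfolding power_mult_distrib N_def nrm_squared by (simp add: ip_def power2_eq_square)
      then show ?thesis using nrm_nonneg by (simp add: abs_le_square_iff[symmetric] abs_mult N_def)
    qed
    have sym: "(nrm d (vsub x v))\<^sup>2 = N\<^sup>2"
      by (simp add: N_def nrm_squared h_def ip_vsub_left ip_vsub_right ip_commute[of d x v])
    have "- \<sigma> / 2 * N\<^sup>2 \<le> g v - g x - ip d (G x) h"
      using q v x by (simp add: quad_bounds_def N_def nrm_squared h_def)
    moreover have cN: "c * N\<^sup>2 = 1 / (2 * \<gamma>) * N\<^sup>2 - \<sigma> / 2 * N\<^sup>2" by (simp add: c_def field_simps)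
    ultimately have "\<Phi> v - \<Phi> x \<ge> ip d (G x) h + c * N\<^sup>2"
      unfolding \<Phi>_def sym cN by (simp add: nrm_def ip_def vsub_def)
    moreover have "nrm d (G x) * N \<le> c * N * N"
      using NR c nrm_nonneg[of d h] by (intro mult_right_mono) (auto simp: R_def N_def field_simps)
    ultimately show ?thesis using cs by (simp add: power2_eq_square mult.assoc)
  qed
  have "\<Phi> u \<le> \<Phi> v" if "v \<in> vsp d" for v
    using out[OF that] u(2)[of v] u(2)[OF xS] by (cases "v \<in> S") auto
  then show ?thesis using u(1) by (auto simp: prox_min_def S_def \<Phi>_def)
qed

lemma prox_min_prox:
  assumes q: "quad_bounds d (- \<sigma>) L g G" and \<gamma>: "1 / \<gamma> > \<sigma>" and x: "x \<in> vsp d"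
  shows "prox_min d \<gamma> g x (prox d \<gamma> g x)"
proof -
  have "\<exists>!u. prox_min d \<gamma> g x u" using prox_min_exists[OF assms] prox_min_unique[OF q \<gamma>] by blast
  from theI'[OF this] show ?thesis unfolding prox_def prox_min_def .
qed

text \<open>
  The algorithm may use the direction of \<open>x0\<close> itself, so translating \<open>x0\<close> to the origin is not
  enough. A reflection turns \<open>x0\<close> into the last coordinate direction, which the
  hard functions ignore.
\<close>

definition reflection :: "nat \<Rightarrow> vec \<Rightarrow> (vec \<Rightarrow> vec) \<Rightarrow> bool" where
  "reflection d x0 H \<longleftrightarrow>
     (\<forall>x\<in>vsp d. H x \<in> vsp d) \<and> (\<forall>x y. ip d (H x) y = ip d x (H y)) \<and> (\<forall>x. H (H x) = x) \<and>
     (\<forall>x y. H (vsub x y) = vsub (H x) (H y)) \<and>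
     (\<forall>N a v. H (\<lambda>j. \<Sum>k<N. a k * v k j) = (\<lambda>j. \<Sum>k<(N::nat). a k * H (v k) j)) \<and>
     (\<forall>l. Suc l < d \<longrightarrow> H x0 l = 0)"

lemma householder_reflection_exists:
  assumes d: "d > 0" and x0: "x0 \<in> vsp d"
  shows "\<exists>H. reflection d x0 H"
proof -
  define r where "r = nrm d x0"
  define e :: vec where "e = (\<lambda>j. if Suc j = d then 1 else 0)"
  \<comment> \<open>The Householder reflection along \<open>u\<close> exchanges \<open>x0\<close>
    and \<open>r * e\<close>, which have equal norms. If \<open>u = 0\<close>, then
    \<open>2 / s\<close> is \<open>0\<close> and \<open>H\<close> is the identity.\<close>
  define u where "u = (\<lambda>j. x0 j - r * e j)"
  define s where "s = ip d u u"
  define H where "H = (\<lambda>x j. x j - 2 / s * ip d u x * u j)"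
  have e: "e \<in> vsp d" using d by (auto simp: vsp_def e_def)
  have u: "u \<in> vsp d" using x0 e by (auto simp: vsp_def u_def)
  have ip_add: "ip d x (\<lambda>j. y j - c * z j) = ip d x y - c * ip d x z" for x y z c
    by (simp add: ip_def sum_subtractf sum_distrib_left algebra_simps)
  have ip_add': "ip d (\<lambda>j. y j - c * z j) x = ip d y x - c * ip d z x" for x y z c
    by (simp add: ip_def sum_subtractf sum_distrib_left algebra_simps)
  have s0: "u = (\<lambda>_. 0)" if "s = 0" using that ip_self_eq_0[OF u] by (simp add: s_def)
  have inv: "H (H x) = x" for x
  proof (cases "s = 0")
    case False
    have "ip d u (H x) = - ip d u x" using False unfolding H_def ip_add s_def[symmetric] by simp
    then show ?thesis by (auto simp: H_def fun_eq_iff)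
  qed (simp add: H_def)
  have lin: "H (\<lambda>j. \<Sum>k<N. a k * v k j) = (\<lambda>j. \<Sum>k<(N::nat). a k * H (v k) j)" for N a v
  proof -
    have "ip d u (\<lambda>j. \<Sum>k<N. a k * v k j) = (\<Sum>k<N. a k * ip d u (v k))"
      unfolding ip_def sum_distrib_left by (subst sum.swap) (simp add: mult_ac)
    then show ?thesis
      by (auto simp: H_def fun_eq_iff sum_subtractf right_diff_distrib sum_distrib_left sum_distrib_right
          sum_divide_distrib mult_ac)
  qed
  have "ip d e e = 1"
  proof -
    have "ip d e e = (\<Sum>j<d. if j = d - 1 then 1 else 0)" unfolding ip_def e_def using d by (intro sum.cong) auto
    then show ?thesis using d by simp
  qed
  moreover have "ip d x0 x0 = r\<^sup>2" by (simp add: r_def nrm_squared)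
  ultimately have s2: "s = 2 * ip d u x0"
    unfolding s_def u_def ip_add ip_add' by (simp add: ip_commute[of d x0 e] algebra_simps power2_eq_square)
  have "H x0 l = 0" if "Suc l < d" for l
  proof (cases "s = 0")
    case True
    then have "x0 l = r * e l" using s0 by (auto simp: u_def fun_eq_iff)
    then show ?thesis using True that by (simp add: H_def e_def)
  next
    case False
    then have "H x0 l = x0 l - u l" using s2 by (simp add: H_def)
    then show ?thesis using that by (simp add: u_def e_def)
  qed
  moreover have "H x \<in> vsp d" if "x \<in> vsp d" for x using that u by (auto simp: H_def vsp_def)
  moreover have "ip d (H x) y = ip d x (H y)" for x y
    unfolding H_def ip_add ip_add' by (simp add: ip_commute[of d x u])
  moreover have "H (vsub x y) = vsub (H x) (H y)" for x y
    unfolding H_def ip_vsub_right by (auto simp: vsub_def fun_eq_iff algebra_simps)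
  ultimately show ?thesis using inv lin unfolding reflection_def by blast
qed

lemma quad_bounds_reflection:
  assumes H: "reflection d x0 H" and q: "quad_bounds d l L g G"
  shows "quad_bounds d l L (\<lambda>x. g (H x)) (\<lambda>y. H (G (H y)))"
proof -
  have eq: "ip d (vsub (H x) (H y)) (vsub (H x) (H y)) = ip d (vsub x y) (vsub x y)"
    "ip d (H (G (H y))) (vsub x y) = ip d (G (H y)) (vsub (H x) (H y))" for x y
    using H unfolding reflection_def by metis+
  have cl: "H x \<in> vsp d" if "x \<in> vsp d" for x using H that by (simp add: reflection_def)
  show ?thesis
    unfolding quad_bounds_def
  proof (intro conjI ballI)
    fix y assume "y \<in> vsp d"
    then show "H (G (H y)) \<in> vsp d" using q cl by (simp add: quad_bounds_def)
  next
    fix x y assume "x \<in> vsp d" "y \<in> vsp d"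
    then have "H x \<in> vsp d" "H y \<in> vsp d" by (auto intro: cl)
    then have "l / 2 * ip d (vsub (H x) (H y)) (vsub (H x) (H y)) \<le> g (H x) - g (H y) - ip d (G (H y)) (vsub (H x) (H y))"
      "g (H x) - g (H y) - ip d (G (H y)) (vsub (H x) (H y)) \<le> L / 2 * ip d (vsub (H x) (H y)) (vsub (H x) (H y))"
      using q by (auto simp: quad_bounds_def)
    then show "l / 2 * ip d (vsub x y) (vsub x y) \<le> g (H x) - g (H y) - ip d (H (G (H y))) (vsub x y)"
      "g (H x) - g (H y) - ip d (H (G (H y))) (vsub x y) \<le> L / 2 * ip d (vsub x y) (vsub x y)"
      unfolding eq .
  qed
qed

section \<open>Draws of a PIFO algorithm\<close>

lemma run_Suc_iter:
  "run d F gam x0 upd I (Suc t) = run d F gam x0 upd I t @ [pifo_query d F (gam (Suc t)) (I t) (iter d F gam x0 upd I t)]"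
  by (simp add: iter_def Let_def)

lemma length_run: "length (run d F gam x0 upd I t) = t"
  by (induction t) (simp_all add: Let_def)

lemma take_run: "k \<le> t \<Longrightarrow> take k (run d F gam x0 upd I t) = run d F gam x0 upd I k"
  by (induction t) (auto simp: Let_def length_run le_Suc_eq)

text \<open>Independence: \<open>q (I s)\<close> is an extra factor at position \<open>s\<close>,
  the sum of products factors over positions, and all other positions contribute
  \<open>1\<close>.\<close>

lemma expected_sum_of_draws:
  fixes p q :: "nat \<Rightarrow> real"
  assumes p: "(\<Sum>i<n. p i) = 1"
  shows "(\<Sum>I\<in>{..<t} \<rightarrow>\<^sub>E {..<n}. (\<Prod>k<t. p (I k)) * (\<Sum>s<t. q (I s))) = real t * (\<Sum>i<n. p i * q i)"
proof -
  have "(\<Sum>I\<in>{..<t} \<rightarrow>\<^sub>E {..<n}. (\<Prod>k<t. p (I k)) * q (I s)) = (\<Sum>i<n. p i * q i)" if s: "s < t" for s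
  proof -
    have "(\<Prod>k<t. p (I k)) * q (I s) = (\<Prod>k<t. p (I k) * (if k = s then q (I k) else 1))" for I
      using s by (simp add: prod.distrib)
    then have "(\<Sum>I\<in>{..<t} \<rightarrow>\<^sub>E {..<n}. (\<Prod>k<t. p (I k)) * q (I s))
        = (\<Prod>k<t. \<Sum>i<n. p i * (if k = s then q i else 1))"
      by (simp add: prod_sum_PiE)
    also have "\<dots> = (\<Prod>k<t. if k = s then (\<Sum>i<n. p i * q i) else 1)"
      by (rule prod.cong) (auto simp: p)
    finally show ?thesis using s by simp
  qed
  then show ?thesis unfolding sum_distrib_left[of "prod _ _"] by (subst sum.swap) simp
qed

text \<open>The smallest probability is at most \<open>1 / n\<close> and the second smallest at most
  \<open>1 / (n - 1)\<close>, which is at most \<open>2 / n\<close>.\<close>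

lemma exists_two_rare_indices:
  fixes p :: "nat \<Rightarrow> real"
  assumes n: "n \<ge> 2" and p: "(\<Sum>i<n. p i) = 1" "\<And>i. i < n \<Longrightarrow> p i \<ge> 0"
  obtains A B where "A < n" "B < n" "A \<noteq> B" "p A + p B \<le> 3 / real n"
proof -
  obtain A where A: "A < n" "\<And>i. i < n \<Longrightarrow> p A \<le> p i"
    using n arg_min_if_finite[of "{..<n}" p]
    by (metis finite_lessThan lessThan_iff lessThan_empty_iff not_less not_numeral_le_zero)
  have ne: "{..<n} - {A} \<noteq> {}"
  proof
    assume "{..<n} - {A} = {}"
    then have "card {..<n} \<le> card {A}" by (intro card_mono) auto
    then show False using n by simp
  qed
  obtain B where B: "B < n" "B \<noteq> A" "\<And>i. i < n \<Longrightarrow> i \<noteq> A \<Longrightarrow> p B \<le> p i"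
    using arg_min_if_finite[of "{..<n} - {A}" p] ne by (metis DiffD1 DiffD2 DiffI finite_Diff finite_lessThan insertI1 lessThan_iff not_less singletonD)
  have "real (card {..<n}) * p A \<le> (\<Sum>i<n. p i)" by (rule sum_bounded_below) (use A in auto)
  then have a: "p A \<le> 1 / real n" using n p by (simp add: field_simps)
  have "real (card ({..<n} - {A})) * p B \<le> (\<Sum>i\<in>{..<n} - {A}. p i)" by (rule sum_bounded_below) (use B in auto)
  also have "\<dots> \<le> (\<Sum>i<n. p i)" by (rule sum_mono2) (use p in auto)
  finally have "(real n - 1) * p B \<le> 1" using A n p by simp
  moreover have "real n / 2 * p B \<le> (real n - 1) * p B" using n p B by (intro mult_right_mono) auto
  ultimately have "p B \<le> 2 / real n" using n by (simp add: field_simps)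
  then have "p A + p B \<le> 3 / real n" using a n by (simp add: field_simps)
  then show ?thesis using that A B by metis
qed

section \<open>The hard instance\<close>

text \<open>The coordinates below \<open>m\<close> form the chain; coordinate \<open>m\<close> is
  the spare one that carries the reflected \<open>x0\<close>. \<open>K\<close> scales the values and
  \<open>b\<close> the coordinates. The bounds on \<open>\<sigma>\<close> and \<open>L\<close>
  budget curvature \<open>K * w\<^sup>2\<close> for the wells and \<open>2 * n * K\<close> for the
  links.\<close>

locale chain =
  fixes m n A B :: nat and K w b \<sigma> L :: real and x0 :: vec and H :: "vec \<Rightarrow> vec"
  assumes AB: "A \<noteq> B" "A < n" "B < n"
    and K: "K > 0" and w: "0 < w" "w \<le> 1" and b: "b > 0"
    and K\<sigma>: "K * w\<^sup>2 \<le> \<sigma>" and KL: "K * (2 * real n + w\<^sup>2) \<le> L"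
    and H: "reflection (Suc m) x0 H" and x0: "x0 \<in> vsp (Suc m)"
begin

abbreviation "d \<equiv> Suc m"

text \<open>The weak first link brings the value at \<open>x0\<close> down to order
  \<open>w\<close>, yet still gives the initial slope of order \<open>w\<close> on which the
  gradient estimate relies.\<close>

definition coef :: "nat \<Rightarrow> real" where "coef j = (if j = 0 then w else 1)"

definition prev :: "vec \<Rightarrow> nat \<Rightarrow> real" where "prev y j = (if j = 0 then b else y (j - 1))"

definition link :: "nat \<Rightarrow> vec \<Rightarrow> real" where "link j y = coef j / 2 * (prev y j - y j)\<^sup>2"

definition link_grad :: "nat \<Rightarrow> vec \<Rightarrow> vec" where
  "link_grad j y l = (if l = j then coef j * (y j - prev y j) else 0) + (if Suc l = j then y l - y j else 0)"

definition owner :: "nat \<Rightarrow> nat" where "owner j = (if even j then A else B)"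

text \<open>The factor \<open>real n\<close> is undone by averaging, as each link has exactly one
  owner.\<close>

definition phi :: "nat \<Rightarrow> vec \<Rightarrow> real" where
  "phi i y = K * (w\<^sup>2 * (\<Sum>j<m. well b (y j)) + real n * (\<Sum>j<m. if owner j = i then link j y else 0))"

definition phi_grad :: "nat \<Rightarrow> vec \<Rightarrow> vec" where
  "phi_grad i y l = (if l < m then K * (w\<^sup>2 * well' b (y l) +
      real n * (\<Sum>j<m. if owner j = i then link_grad j y l else 0)) else 0)"

text \<open>Meant for differences of two points: there the boundary value \<open>b\<close> cancels,
  leaving \<open>0\<close> in front of coordinate \<open>0\<close>.\<close>

definition dif :: "vec \<Rightarrow> nat \<Rightarrow> real" where "dif h j = h j - (if j = 0 then 0 else h (j - 1))"

section \<open>Curvature of the component functions\<close>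

lemma owner_Suc: "owner (Suc j) \<noteq> owner j"
  using AB by (auto simp: owner_def)

lemma owner_less: "owner j < n"
  using AB by (auto simp: owner_def)

lemma link_grad_sum:
  assumes "j < m"
  shows "(\<Sum>l<m. link_grad j y l * h l) = coef j * (y j - prev y j) * dif h j"
proof (cases j)
  case 0
  have "(\<Sum>l<m. link_grad j y l * h l) = (\<Sum>l<m. if l = 0 then coef 0 * (y 0 - prev y 0) * h 0 else 0)"
    by (rule sum.cong) (auto simp: link_grad_def 0)
  then show ?thesis using assms by (simp add: dif_def 0)
next
  case (Suc q)
  have "(\<Sum>l<m. link_grad j y l * h l)
      = (\<Sum>l<m. (if l = j then (y j - y q) * h j else 0) + (if l = q then (y q - y j) * h q else 0))"
    by (rule sum.cong) (auto simp: link_grad_def coef_def prev_def Suc)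
  also have "\<dots> = (y j - y q) * h j + (y q - y j) * h q" using assms Suc by (simp add: sum.distrib)
  finally show ?thesis by (simp add: Suc coef_def prev_def dif_def algebra_simps)
qed

lemma link_remainder:
  assumes "j < m"
  shows "link j x - link j y - (\<Sum>l<m. link_grad j y l * vsub x y l) = coef j / 2 * (dif (vsub x y) j)\<^sup>2"
proof -
  define s t where "s = prev x j - x j" and "t = prev y j - y j"
  have "dif (vsub x y) j = t - s" "y j - prev y j = - t"
    by (auto simp: dif_def prev_def vsub_def s_def t_def)
  then show ?thesis
    unfolding link_grad_sum[OF assms] link_def s_def[symmetric] t_def[symmetric]
    by (simp only:) (simp add: power2_eq_square field_simps)
qed

lemma dif_squared_le: "coef j / 2 * (dif h j)\<^sup>2 \<le> (h j)\<^sup>2 + (if j = 0 then 0 else (h (j - 1))\<^sup>2)"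
proof -
  have 1: "(u - v)\<^sup>2 \<le> 2 * (u\<^sup>2 + v\<^sup>2)" for u v :: real
    using zero_le_power2[of "u + v"] by (simp add: power2_eq_square algebra_simps)
  have "coef j / 2 * (dif h j)\<^sup>2 \<le> 1 / 2 * (dif h j)\<^sup>2" using w by (intro mult_right_mono) (auto simp: coef_def)
  also have "\<dots> \<le> (h j)\<^sup>2 + (if j = 0 then 0 else (h (j - 1))\<^sup>2)"
    using 1[of "h j" "if j = 0 then 0 else h (j - 1)"] by (auto simp: dif_def)
  finally show ?thesis .
qed

text \<open>Links of one owner touch disjoint pairs of coordinates, because neighbouring links have
  different owners. The subtracted term reserves coordinate \<open>M - 1\<close> for link
  \<open>M\<close> and carries the induction.\<close>

lemma disjoint_links_sum:
  fixes h :: vec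
  shows "(\<Sum>j<M. if owner j = i then (h j)\<^sup>2 + (if j = 0 then 0 else (h (j - 1))\<^sup>2) else 0)
    \<le> (\<Sum>j<M. (h j)\<^sup>2) - (if owner M = i \<and> M \<noteq> 0 then (h (M - 1))\<^sup>2 else 0)" (is "?S M \<le> ?T M - ?R M")
proof (induction M)
  case (Suc M)
  have "?S (Suc M) = ?S M + (if owner M = i then (h M)\<^sup>2 + (if M = 0 then 0 else (h (M - 1))\<^sup>2) else 0)"
    "?T (Suc M) = ?T M + (h M)\<^sup>2" by simp_all
  moreover have "?R (Suc M) = (if owner (Suc M) = i then (h M)\<^sup>2 else 0)" by simp
  moreover have "(if owner M = i then (h M)\<^sup>2 + (if M = 0 then 0 else (h (M - 1))\<^sup>2) else 0)
      \<le> ?R M + (h M)\<^sup>2 - (if owner (Suc M) = i then (h M)\<^sup>2 else 0)"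
    using owner_Suc[of M] by auto
  ultimately show ?case using Suc by linarith
qed simp

lemma phi_grad_ip:
  "ip d (phi_grad i y) h = K * (w\<^sup>2 * (\<Sum>l<m. well' b (y l) * h l)
     + real n * (\<Sum>j<m. if owner j = i then (\<Sum>l<m. link_grad j y l * h l) else 0))"
proof -
  have "ip d (phi_grad i y) h = (\<Sum>l<m. K * (w\<^sup>2 * (well' b (y l) * h l)) +
     K * (real n * ((\<Sum>j<m. if owner j = i then link_grad j y l else 0) * h l)))"
    by (simp add: ip_def phi_grad_def algebra_simps)
  also have "\<dots> = K * (w\<^sup>2 * (\<Sum>l<m. well' b (y l) * h l)) + 
      K * (real n * (\<Sum>l<m. (\<Sum>j<m. if owner j = i then link_grad j y l else 0) * h l))"
    by (simp add: sum.distrib sum_distrib_left)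
  also have "(\<Sum>l<m. (\<Sum>j<m. if owner j = i then link_grad j y l else 0) * h l) =
      (\<Sum>j<m. \<Sum>l<m. (if owner j = i then link_grad j y l else 0) * h l)"
    unfolding sum_distrib_right by (rule sum.swap)
  also have "\<dots> = (\<Sum>j<m. if owner j = i then (\<Sum>l<m. link_grad j y l * h l) else 0)"
    by (rule sum.cong) auto
  finally show ?thesis by (simp add: distrib_left)
qed

lemma phi_quad_bounds: "quad_bounds d (- \<sigma>) L (phi i) (phi_grad i)"
  unfolding quad_bounds_def
proof (intro conjI ballI)
  fix y assume "y \<in> vsp d"
  show "phi_grad i y \<in> vsp d" by (auto simp: vsp_def phi_grad_def)
next
  fix x y
  define h where "h = vsub x y"
  define T where "T = (\<Sum>l<m. (h l)\<^sup>2)"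
  define RW where "RW = (\<Sum>j<m. well b (x j) - well b (y j) - well' b (y j) * h j)"
  define RL where "RL = (\<Sum>j<m. if owner j = i then coef j / 2 * (dif h j)\<^sup>2 else 0)"
  have T: "T \<le> ip d h h" by (simp add: T_def ip_def power2_eq_square)
  have T0: "T \<ge> 0" by (auto simp: T_def intro: sum_nonneg)
  have "RL = (\<Sum>j<m. (if owner j = i then link j x else 0) - (if owner j = i then link j y else 0)
      - (if owner j = i then (\<Sum>l<m. link_grad j y l * h l) else 0))"
    unfolding RL_def h_def by (rule sum.cong) (auto simp: link_remainder)
  then have RL: "RL = (\<Sum>j<m. if owner j = i then link j x else 0) - (\<Sum>j<m. if owner j = i then link j y else 0)
      - (\<Sum>j<m. if owner j = i then (\<Sum>l<m. link_grad j y l * h l) else 0)"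
    by (simp only: sum_subtractf)
  have RW: "RW = (\<Sum>j<m. well b (x j)) - (\<Sum>j<m. well b (y j)) - (\<Sum>j<m. well' b (y j) * h j)"
    unfolding RW_def by (simp only: sum_subtractf)
  have eq: "phi i x - phi i y - ip d (phi_grad i y) h = K * (w\<^sup>2 * RW + real n * RL)"
    unfolding phi_grad_ip phi_def RW RL by (simp only: ring_distribs)
  have "RW \<ge> (\<Sum>j<m. - ((h j)\<^sup>2 / 2))"
    unfolding RW_def by (rule sum_mono) (use well_lower[OF b] in \<open>auto simp: h_def vsub_def\<close>)
  then have RW1: "RW \<ge> - T / 2" by (simp add: T_def sum_negf sum_divide_distrib)
  have "RW \<le> (\<Sum>j<m. (h j)\<^sup>2 / 2)"
    unfolding RW_def by (rule sum_mono) (use well_upper[OF b] in \<open>auto simp: h_def vsub_def\<close>)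
  then have RW2: "RW \<le> T / 2" by (simp add: T_def sum_divide_distrib)
  have RL1: "RL \<ge> 0" unfolding RL_def by (rule sum_nonneg) (use w in \<open>auto simp: coef_def\<close>)
  have "RL \<le> (\<Sum>j<m. if owner j = i then (h j)\<^sup>2 + (if j = 0 then 0 else (h (j - 1))\<^sup>2) else 0)"
    unfolding RL_def by (rule sum_mono) (use dif_squared_le in auto)
  also have "\<dots> \<le> T" using disjoint_links_sum[where M = m and h = h and i = i] unfolding T_def
    by (auto split: if_splits intro: order_trans)
  finally have RL2: "RL \<le> T" .
  \<comment> \<open>The links are convex, so only the wells bend downwards.\<close>
  have "- \<sigma> / 2 * ip d h h \<le> - \<sigma> / 2 * T" using T K\<sigma> K w
    by (intro mult_left_mono_neg) (auto intro: order_trans[OF _ K\<sigma>])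
  also have "\<dots> \<le> - (K * w\<^sup>2) / 2 * T" using K\<sigma> T0 by (intro mult_right_mono) auto
  also have "\<dots> = K * (w\<^sup>2 * (- T / 2))" by simp
  also have "\<dots> \<le> K * (w\<^sup>2 * RW)" using RW1 K by (intro mult_left_mono) auto
  also have "\<dots> \<le> K * (w\<^sup>2 * RW + real n * RL)" using RL1 K by (intro mult_left_mono) auto
  finally show "- \<sigma> / 2 * ip d (vsub x y) (vsub x y) \<le> phi i x - phi i y - ip d (phi_grad i y) (vsub x y)"
    unfolding h_def[symmetric] eq .
  have "K * (w\<^sup>2 * RW + real n * RL) \<le> K * (w\<^sup>2 * (T / 2) + real n * T)"
    using K RW2 RL2 by (intro mult_left_mono add_mono) auto
  also have "\<dots> = K * (2 * real n + w\<^sup>2) * (T / 2)" by (simp add: algebra_simps)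
  also have "\<dots> \<le> L * (T / 2)" using KL T0 by (intro mult_right_mono) auto
  also have "\<dots> \<le> L * (ip d h h / 2)"
  proof (intro mult_left_mono)
    have "0 \<le> K * (2 * real n + w\<^sup>2)" using K by simp
    then show "0 \<le> L" using KL by linarith
  qed (use T in auto)
  finally show "phi i x - phi i y - ip d (phi_grad i y) (vsub x y) \<le> L / 2 * ip d (vsub x y) (vsub x y)"
    unfolding h_def[symmetric] eq by simp
qed

section \<open>Growth of the support under queries\<close>

lemma phi_grad_zero_chain:
  assumes k: "owner k \<noteq> i" and y: "\<And>l. k \<le> l \<Longrightarrow> l < m \<Longrightarrow> y l = 0" and l: "k \<le> l"
  shows "phi_grad i y l = 0"
proof -
  \<comment> \<open>An owned link that touches a coordinate \<open>l\<close> with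
    \<open>k \<le> l\<close> has index above \<open>k\<close>, as link \<open>k\<close> itself is
    not owned; hence both its ends vanish.\<close>
  have "(if owner j = i then link_grad j y l else 0) = 0" if "j < m" for j
  proof (cases "owner j = i \<and> (l = j \<or> Suc l = j)")
    case True
    then have "j > k" using k l by (metis le_neq_implies_less less_Suc_eq_le)
    then show ?thesis using True y[of j] y[of "j - 1"] y[of l] l that by (auto simp: link_grad_def prev_def)
  qed (auto simp: link_grad_def)
  then show ?thesis using y[OF l] b by (auto simp: phi_grad_def)
qed

definition trunc :: "nat \<Rightarrow> vec \<Rightarrow> vec" where
  "trunc k y = (\<lambda>l. if k \<le> l \<and> l < m then 0 else y l)"

text \<open>Links before \<open>k\<close> are unchanged and links after \<open>k\<close> become
  \<open>0\<close>; only link \<open>k\<close> could grow, and it belongs to another component.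
  Resetting a coordinate raises its well by at most half its square.\<close>

lemma phi_trunc_le:
  assumes k: "owner k \<noteq> i"
  shows "phi i (trunc k y) \<le> phi i y + \<sigma> / 2 * (\<Sum>l<m. if k \<le> l then (y l)\<^sup>2 else 0)"
proof -
  let ?E = "\<Sum>l<m. if k \<le> l then (y l)\<^sup>2 else 0"
  have E: "?E \<ge> 0" by (rule sum_nonneg) auto
  have "(\<Sum>j<m. if owner j = i then link j (trunc k y) else 0) \<le> (\<Sum>j<m. if owner j = i then link j y else 0)"
  proof (rule sum_mono)
    fix j assume j: "j \<in> {..<m}"
    have nn: "link j y \<ge> 0" using w by (auto simp: link_def coef_def)
    show "(if owner j = i then link j (trunc k y) else 0) \<le> (if owner j = i then link j y else 0)"
    proof (cases "owner j = i")
      case True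
      then consider "j < k" | "j > k" using k by (metis linorder_neqE_nat)
      then show ?thesis
      proof cases
        case 1
        then have "link j (trunc k y) = link j y" by (auto simp: link_def prev_def trunc_def)
        then show ?thesis by simp
      next
        case 2
        then have "link j (trunc k y) = 0" using j by (auto simp: link_def prev_def trunc_def)
        then show ?thesis using nn by simp
      qed
    qed simp
  qed
  moreover have "(\<Sum>j<m. well b (trunc k y j)) \<le> (\<Sum>j<m. well b (y j) + 1 / 2 * (if k \<le> j then (y j)\<^sup>2 else 0))"
  proof (rule sum_mono)
    fix j assume "j \<in> {..<m}"
    then show "well b (trunc k y j) \<le> well b (y j) + 1 / 2 * (if k \<le> j then (y j)\<^sup>2 else 0)"
      using well_ge_quadratic[of "y j" b] b by (auto simp: trunc_def)
  qed
  then have "(\<Sum>j<m. well b (trunc k y j)) \<le> (\<Sum>j<m. well b (y j)) + 1 / 2 * ?E"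
    by (simp only: sum.distrib sum_distrib_left)
  ultimately have "phi i (trunc k y) \<le> K * (w\<^sup>2 * ((\<Sum>j<m. well b (y j)) + 1 / 2 * ?E) + real n * (\<Sum>j<m. if owner j = i then link j y else 0))"
    unfolding phi_def using K by (intro mult_left_mono add_mono) auto
  also have "\<dots> = phi i y + K * w\<^sup>2 * (?E / 2)" by (simp add: phi_def algebra_simps)
  also have "\<dots> \<le> phi i y + \<sigma> * (?E / 2)" using K\<sigma> E by (intro add_left_mono mult_right_mono) auto
  finally show ?thesis by simp
qed

definition F :: "nat \<Rightarrow> vec \<Rightarrow> real" where "F i x = phi i (H x)"

text \<open>Coordinate \<open>m\<close> is left free, so that \<open>x0\<close> lies in
  \<open>W 0\<close>.\<close>

definition W :: "nat \<Rightarrow> vec set" where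
  "W k = {x \<in> vsp d. \<forall>l. k \<le> l \<and> l < m \<longrightarrow> H x l = 0}"

lemma F_quad_bounds: "quad_bounds d (- \<sigma>) L (F i) (\<lambda>y. H (phi_grad i (H y)))"
  unfolding F_def using quad_bounds_reflection[OF H phi_quad_bounds] .

lemma W_mono: "k \<le> k' \<Longrightarrow> W k \<subseteq> W k'"
  by (auto simp: W_def)

lemma H_props:
  "x \<in> vsp d \<Longrightarrow> H x \<in> vsp d" "ip d (H x) y = ip d x (H y)" "H (H x) = x"
  "H (vsub x y) = vsub (H x) (H y)"
  using H unfolding reflection_def by blast+

lemma grad_in_W:
  assumes x: "x \<in> W k" and k: "owner k \<noteq> i"
  shows "grad d (F i) x \<in> W k"
proof -
  have xv: "x \<in> vsp d" using x by (simp add: W_def)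
  have "grad d (F i) x = H (phi_grad i (H x))" by (rule quad_bounds_grad[OF F_quad_bounds xv])
  moreover have "H (phi_grad i (H x)) \<in> vsp d"
    using F_quad_bounds xv by (auto simp: quad_bounds_def)
  moreover have "phi_grad i (H x) l = 0" if "k \<le> l" for l
    by (rule phi_grad_zero_chain[OF k _ that]) (use x in \<open>auto simp: W_def\<close>)
  ultimately show ?thesis by (simp add: W_def H_props)
qed

text \<open>Truncating the minimiser raises the function by at most \<open>\<sigma> / 2 * E\<close>
  and lowers the penalty by \<open>1 / (2 * \<gamma>) * E\<close>. The truncated point is thus a
  minimiser too, and uniqueness identifies the two.\<close>

lemma prox_in_W:
  assumes x: "x \<in> W k" and k: "owner k \<noteq> i" and \<gamma>: "1 / \<gamma> > \<sigma>"
  shows "prox d \<gamma> (F i) x \<in> W k"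
proof -
  have xv: "x \<in> vsp d" using x by (simp add: W_def)
  define u where "u = prox d \<gamma> (F i) x"
  have min: "prox_min d \<gamma> (F i) x u" unfolding u_def by (rule prox_min_prox[OF F_quad_bounds \<gamma> xv])
  then have uv: "u \<in> vsp d" by (simp add: prox_min_def)
  define t where "t = trunc k (H u)"
  define E where "E = (\<Sum>l<m. if k \<le> l then (H u l)\<^sup>2 else 0)"
  have E: "E \<ge> 0" unfolding E_def by (rule sum_nonneg) auto
  have tv: "t \<in> vsp d" using H_props(1)[OF uv] by (auto simp: t_def trunc_def vsp_def)
  have iso: "(nrm d (vsub x v))\<^sup>2 = (nrm d (vsub (H x) (H v)))\<^sup>2" for v
    unfolding nrm_squared by (metis H_props(2-4))
  have "(nrm d (vsub (H x) (H u)))\<^sup>2 = (nrm d (vsub (H x) t))\<^sup>2 + E"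
    unfolding nrm_squared ip_def E_def sum.lessThan_Suc
    using x by (simp add: t_def trunc_def vsub_def W_def sum.distrib[symmetric])
      (rule sum.cong, auto simp: power2_eq_square)
  then have nn: "(nrm d (vsub x u))\<^sup>2 = (nrm d (vsub x (H t)))\<^sup>2 + E" by (simp add: iso H_props)
  have "F i (H t) + 1 / (2 * \<gamma>) * (nrm d (vsub x (H t)))\<^sup>2 \<le> F i u + 1 / (2 * \<gamma>) * (nrm d (vsub x u))\<^sup>2"
  proof -
    have "\<sigma> / 2 * E \<le> 1 / (2 * \<gamma>) * E" using \<gamma> E by (intro mult_right_mono) auto
    moreover have "F i (H t) \<le> F i u + \<sigma> / 2 * E"
      unfolding F_def H_props(3) t_def E_def by (rule phi_trunc_le[OF k])
    ultimately show ?thesis unfolding nn by (simp add: algebra_simps)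
  qed
  then have "prox_min d \<gamma> (F i) x (H t)"
    using min H_props(1)[OF tv] unfolding prox_min_def by (meson order_trans)
  then have "H t = u" using prox_min_unique[OF F_quad_bounds \<gamma>] min by blast
  then have "H u = t" using H_props(3) by metis
  then have "H u l = 0" if "k \<le> l" "l < m" for l
    using that unfolding \<open>H u = t\<close> by (simp add: t_def trunc_def)
  then show ?thesis using uv by (simp add: W_def u_def)
qed

text \<open>Every draw of \<open>A\<close> or \<open>B\<close> counts, even one that unlocks no
  coordinate, so the count depends on the drawn indices alone.\<close>

definition bump :: "nat \<Rightarrow> nat" where "bump i = (if i = A \<or> i = B then 1 else 0)"

lemma query_in_W:
  assumes x: "x \<in> W k" and \<gamma>: "1 / \<gamma> > \<sigma>"
  shows "grad d (F i) x \<in> W (k + bump i)" "prox d \<gamma> (F i) x \<in> W (k + bump i)"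
proof -
  \<comment> \<open>If \<open>i\<close> owns link \<open>k\<close>, it does not own link
    \<open>k + 1\<close>, so admitting one more coordinate suffices.\<close>
  obtain k' where k': "k \<le> k'" "k' \<le> k + bump i" "owner k' \<noteq> i"
  proof (cases "owner k = i")
    case True
    then have "bump i = 1" "owner (k + 1) \<noteq> i" using owner_Suc[of k] by (auto simp: bump_def owner_def split: if_splits)
    then show ?thesis using that[of "k + 1"] by auto
  qed (use that[of k] in auto)
  have "x \<in> W k'" using x W_mono[OF k'(1)] by blast
  then show "grad d (F i) x \<in> W (k + bump i)" "prox d \<gamma> (F i) x \<in> W (k + bump i)"
    using grad_in_W[OF _ k'(3)] prox_in_W[OF _ k'(3) \<gamma>] W_mono[OF k'(2)] by blast+
qed

lemma lspan_subset_W: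
  assumes "set vs \<subseteq> W k"
  shows "lspan vs \<subseteq> W k"
proof
  fix x assume "x \<in> lspan vs"
  then obtain a where x: "x = (\<lambda>j. \<Sum>k<length vs. a k * (vs ! k) j)" unfolding lspan_def by blast
  have nth: "vs ! q \<in> W k" if "q < length vs" for q using assms that nth_mem by blast
  have "H x = (\<lambda>j. \<Sum>k<length vs. a k * H (vs ! k) j)"
    unfolding x using H unfolding reflection_def by blast
  then show "x \<in> W k" using nth unfolding W_def x vsp_def by auto
qed

lemma x0_in_W: "x0 \<in> W 0"
  using H x0 by (auto simp: W_def reflection_def)

definition draws :: "(nat \<Rightarrow> nat) \<Rightarrow> nat \<Rightarrow> nat" where
  "draws I t = (\<Sum>s<t. bump (I s))"

lemma iterates_in_W:
  assumes P: "pifo n d p x0 gam upd" and gam: "\<And>t. t \<ge> 1 \<Longrightarrow> 1 / gam t > \<sigma>"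
  shows "iter d F gam x0 upd I t \<in> W (draws I t)"
proof -
  let ?it = "iter d F gam x0 upd I" and ?run = "run d F gam x0 upd I"
  \<comment> \<open>The span allows all earlier iterates and observations, so the invariant covers
    the whole history.\<close>
  have "(\<forall>k\<le>t. ?it k \<in> W (draws I t)) \<and> (\<forall>ob\<in>set (?run t). obs_grad ob \<in> W (draws I t) \<and> obs_prox ob \<in> W (draws I t))"
  proof (induction t)
    case 0
    then show ?case by (simp add: iter_def x0_in_W draws_def)
  next
    case (Suc t)
    have up: "W (draws I t) \<subseteq> W (draws I (Suc t))" by (rule W_mono) (simp add: draws_def)
    have "draws I (Suc t) = draws I t + bump (I t)" by (simp add: draws_def)
    then have new: "grad d (F (I t)) (?it t) \<in> W (draws I (Suc t))"
        "prox d (gam (Suc t)) (F (I t)) (?it t) \<in> W (draws I (Suc t))"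
      using query_in_W[of "?it t" "draws I t" "gam (Suc t)" "I t"] gam[of "Suc t"] Suc by auto
    have obs: "obs_grad ob \<in> W (draws I (Suc t))" "obs_prox ob \<in> W (draws I (Suc t))"
      if "ob \<in> set (?run (Suc t))" for ob
      using that new Suc up unfolding run_Suc_iter
      by (auto simp: pifo_query_def obs_grad_def obs_prox_def)
    have old: "?it k \<in> W (draws I (Suc t))" if "k \<le> t" for k using Suc up that by blast
    have upd_it: "upd (take k (?run (Suc t))) = ?it k" if "k \<in> set [1..<Suc t]" for k
      using that by (subst take_run) (auto simp: iter_def simp del: run.simps)
    have span: "upd os \<in> lspan (x0 # map (\<lambda>k. upd (take k os)) [1..<length os]
                        @ map obs_grad os @ map obs_prox os)" if "length os \<ge> 1" for os
      using P that unfolding pifo_def by blast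
    have "?it (Suc t) \<in> lspan (x0 # map (\<lambda>k. upd (take k (?run (Suc t)))) [1..<length (?run (Suc t))]
                        @ map obs_grad (?run (Suc t)) @ map obs_prox (?run (Suc t)))"
      unfolding iter_def if_not_P[OF nat.distinct(2)] by (rule span) (simp add: length_run del: run.simps)
    also have "\<dots> \<subseteq> W (draws I (Suc t))"
    proof (rule lspan_subset_W)
      have "x0 \<in> W (draws I (Suc t))" using x0_in_W W_mono[of 0] by blast
      moreover have "upd (take k (?run (Suc t))) \<in> W (draws I (Suc t))" if "k \<in> set [1..<Suc t]" for k
        unfolding upd_it[OF that] using that by (intro old) auto
      ultimately show "set (x0 # map (\<lambda>k. upd (take k (?run (Suc t)))) [1..<length (?run (Suc t))]
                        @ map obs_grad (?run (Suc t)) @ map obs_prox (?run (Suc t))) \<subseteq> W (draws I (Suc t))"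
        unfolding length_run using obs by (auto simp del: run.simps upt_Suc)
    qed
    finally show ?case using old obs by (auto simp: le_Suc_eq simp del: run.simps)
  qed
  then show ?thesis by blast
qed

section \<open>The averaged function and its expected gradient norm\<close>

lemma n_pos: "n > 0" using AB by simp

lemma sum_owner:
  fixes X :: "nat \<Rightarrow> real"
  shows "(\<Sum>i<n. \<Sum>j<m. if owner j = i then X j else 0) = (\<Sum>j<m. X j)"
proof -
  have "(\<Sum>i<n. \<Sum>j<m. if owner j = i then X j else 0) = (\<Sum>j<m. \<Sum>i<n. if owner j = i then X j else 0)"
    by (rule sum.swap)
  also have "\<dots> = (\<Sum>j<m. X j)" by (rule sum.cong) (use owner_less in auto)
  finally show ?thesis .
qed

lemma average_phi: "(\<Sum>i<n. phi i y) / real n = K * (w\<^sup>2 * (\<Sum>j<m. well b (y j)) + (\<Sum>j<m. link j y))"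
  using n_pos sum_owner[of "\<lambda>j. link j y"]
  by (simp add: phi_def sum_distrib_left[symmetric] sum.distrib field_simps)

lemma average_phi_grad:
  "l < m \<Longrightarrow> (\<Sum>i<n. phi_grad i y l) / real n = K * (w\<^sup>2 * well' b (y l) + (\<Sum>j<m. link_grad j y l))"
  using n_pos sum_owner[of "\<lambda>j. link_grad j y l"]
  by (simp add: phi_grad_def sum_distrib_left[symmetric] sum.distrib field_simps)

definition f :: "vec \<Rightarrow> real" where "f x = (\<Sum>i<n. F i x) / real n"

lemma f_ge: "f x \<ge> - (K * w\<^sup>2 * real m * b\<^sup>2 / 4)"
proof -
  have "(\<Sum>j<m. well b (H x j)) \<ge> real (card {..<m}) * (- (b\<^sup>2 / 4))"
    by (rule sum_bounded_below) (rule well_ge_const[OF b])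
  then have "w\<^sup>2 * (\<Sum>j<m. well b (H x j)) \<ge> w\<^sup>2 * (real m * (- (b\<^sup>2 / 4)))" by (intro mult_left_mono) auto
  moreover have "(\<Sum>j<m. link j (H x)) \<ge> 0" by (rule sum_nonneg) (use w in \<open>auto simp: link_def coef_def\<close>)
  ultimately have "K * (w\<^sup>2 * (real m * (- (b\<^sup>2 / 4)))) \<le> K * (w\<^sup>2 * (\<Sum>j<m. well b (H x j)) + (\<Sum>j<m. link j (H x)))"
    using K by (intro mult_left_mono) auto
  then show ?thesis unfolding f_def F_def average_phi by (simp add: mult_ac)
qed

lemma f_x0:
  assumes "m > 0"
  shows "f x0 = K * (w * b\<^sup>2 / 2)"
proof -
  have z: "H x0 j = 0" if "j < m" for j using x0_in_W that by (auto simp: W_def)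
  have "(\<Sum>j<m. well b (H x0 j)) = 0" by (rule sum.neutral) (use z b in auto)
  moreover have "(\<Sum>j<m. link j (H x0)) = (\<Sum>j<m. if j = 0 then w * b\<^sup>2 / 2 else 0)"
    by (rule sum.cong) (use z in \<open>auto simp: link_def coef_def prev_def\<close>)
  ultimately show ?thesis using assms unfolding f_def F_def average_phi by simp
qed

lemma grad_f:
  assumes "x \<in> vsp d"
  shows "grad d f x = H (\<lambda>l. (\<Sum>i<n. phi_grad i (H x) l) / real n)"
proof -
  have "quad_bounds d (- \<sigma>) L (\<lambda>x. (\<Sum>i<n. phi i (H x)) / real n) (\<lambda>y. H (\<lambda>l. (\<Sum>i<n. phi_grad i (H y) l) / real n))"
    by (rule quad_bounds_reflection[OF H quad_bounds_average[OF phi_quad_bounds n_pos]])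
  then show ?thesis using quad_bounds_grad assms unfolding f_def F_def by blast
qed

lemma link_grad_total:
  assumes "l < m"
  shows "(\<Sum>j<m. link_grad j y l) = coef l * (y l - prev y l) + (if Suc l < m then y l - y (Suc l) else 0)"
proof -
  have "(\<Sum>j<m. link_grad j y l) = (\<Sum>j<m. (if j = l then coef l * (y l - prev y l) else 0)) + (\<Sum>j<m. (if j = Suc l then y l - y (Suc l) else 0))"
    unfolding link_grad_def sum.distrib by (intro arg_cong2[where f = "(+)"] sum.cong) auto
  then show ?thesis using assms by simp
qed

lemma grad_f_norm_ge:
  assumes x: "x \<in> W k" and k: "k < m"
  shows "nrm d (grad d f x) \<ge> K * b * sqrt (w ^ 3) / 27"
proof -
  have xv: "x \<in> vsp d" using x by (simp add: W_def)
  \<comment> \<open>Division by \<open>b\<close> moves the boundary value to \<open>1\<close>; the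
    spare coordinate is cut off.\<close>
  define y where "y = (\<lambda>j. if j < m then H x j / b else 0)"
  define D where "D = (\<lambda>j. case j of 0 \<Rightarrow> w * (1 - y 0) | Suc j \<Rightarrow> y j - y (Suc j))"
  define g where "g = (\<lambda>j. D (Suc j) - D j + w\<^sup>2 * well' 1 (y j))"
  define G where "G = (\<lambda>l. (\<Sum>i<n. phi_grad i (H x) l) / real n)"
  have yz: "y j = 0" if "j \<ge> k" for j using x that by (auto simp: y_def W_def)
  have Hx: "H x j = b * y j" if "j < m" for j using that b by (simp add: y_def)
  have bound: "(\<Sum>i<m. (g i)\<^sup>2) \<ge> w ^ 3 / 729"
    by (rule chain_gradient_lower_bound[where D = D, OF w yz k]) (auto simp: D_def g_def)
  have G: "G l = K * b * g l" if l: "l < m" for l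
  proof -
    have "well' b (H x l) = b * well' 1 (y l)" using well'_scale[OF b, of "H x l"] l by (simp add: y_def)
    moreover have "coef l * (H x l - prev (H x) l) = - (b * D l)"
      using l Hx by (cases l) (auto simp: coef_def prev_def D_def algebra_simps)
    \<comment> \<open>Coordinate \<open>m - 1\<close> has no outgoing link, which agrees with
      \<open>D m = 0\<close> because \<open>y\<close> vanishes there.\<close>
    moreover have "(if Suc l < m then H x l - H x (Suc l) else 0) = b * D (Suc l)"
    proof (cases "Suc l < m")
      case False
      then have "y l = 0" "y (Suc l) = 0" using yz[of l] yz[of "Suc l"] k l by auto
      then show ?thesis using False by (simp add: D_def)
    qed (use Hx in \<open>auto simp: D_def algebra_simps\<close>)
    ultimately show ?thesis
      unfolding G_def average_phi_grad[OF l] link_grad_total[OF l]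
      by (simp only:) (simp add: g_def algebra_simps)
  qed
  have "(K * b * sqrt (w ^ 3) / 27)\<^sup>2 = (K * b)\<^sup>2 * (w ^ 3 / 729)"
    using w by (simp add: power_mult_distrib power_divide)
  also have "\<dots> \<le> (K * b)\<^sup>2 * (\<Sum>i<m. (g i)\<^sup>2)" using bound by (intro mult_left_mono) auto
  also have "\<dots> = (\<Sum>l<m. (G l)\<^sup>2)" unfolding sum_distrib_left
    by (rule sum.cong) (auto simp: G power_mult_distrib)
  also have "\<dots> \<le> ip d G G" by (simp add: ip_def power2_eq_square)
  also have "\<dots> = (nrm d (grad d f x))\<^sup>2"
    unfolding grad_f[OF xv] G_def[symmetric] nrm_squared by (simp add: H_props)
  finally show ?thesis using nrm_nonneg power2_le_imp_le by blast
qed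

text \<open>Markov's inequality in linear form: \<open>c * (1 - draws I t / m)\<close> is at most
  \<open>c\<close> if fewer than \<open>m\<close> draws hit \<open>A\<close> or \<open>B\<close>,
  and at most \<open>0\<close> otherwise, so it bounds the gradient norm for every index sequence;
  then expectations are taken.\<close>

lemma exp_grad_norm_ge:
  assumes P: "pifo n d p x0 gam upd" and gam: "\<And>t. t \<ge> 1 \<Longrightarrow> 1 / gam t > \<sigma>" and m: "m > 0"
  shows "exp_grad_norm n d F p x0 gam upd t \<ge> K * b * sqrt (w ^ 3) / 27 * (1 - real t * (p A + p B) / real m)"
proof -
  define c where "c = K * b * sqrt (w ^ 3) / 27"
  have c: "c \<ge> 0" using K b w by (simp add: c_def)
  have p: "\<And>i. i < n \<Longrightarrow> p i \<ge> 0" "(\<Sum>i<n. p i) = 1" using P by (auto simp: pifo_def)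
  let ?S = "{..<t} \<rightarrow>\<^sub>E {..<n}"
  have "(\<Sum>i<n. p i * real (bump i)) = (\<Sum>i<n. (if i = A then p A else 0) + (if i = B then p B else 0))"
    by (rule sum.cong) (use AB in \<open>auto simp: bump_def\<close>)
  then have pb: "(\<Sum>i<n. p i * real (bump i)) = p A + p B" using AB by (simp add: sum.distrib)
  have "(\<Prod>k<t. \<Sum>i<n. p i) = (\<Sum>I\<in>?S. \<Prod>k<t. p (I k))" by (rule prod_sum_PiE) auto
  then have one: "(\<Sum>I\<in>?S. \<Prod>k<t. p (I k)) = 1" by (simp add: p)
  have "(\<Sum>I\<in>?S. (\<Prod>k<t. p (I k)) * real (draws I t)) = real t * (p A + p B)"
    using expected_sum_of_draws[OF p(2), of t "\<lambda>i. real (bump i)"] unfolding draws_def of_nat_sum pb .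
  then have "c * (1 - real t * (p A + p B) / real m) = 
     c * ((\<Sum>I\<in>?S. \<Prod>k<t. p (I k)) - (\<Sum>I\<in>?S. (\<Prod>k<t. p (I k)) * real (draws I t)) / real m)"
    by (simp add: one)
  also have "\<dots> = (\<Sum>I\<in>?S. (\<Prod>k<t. p (I k)) * (c * (1 - real (draws I t) / real m)))"
    unfolding sum_divide_distrib sum_subtractf[symmetric] sum_distrib_left by (rule sum.cong) (auto simp: algebra_simps)
  also have "\<dots> \<le> (\<Sum>I\<in>?S. (\<Prod>k<t. p (I k)) * nrm d (grad d f (iter d F gam x0 upd I t)))"
  proof (rule sum_mono)
    fix I assume I: "I \<in> ?S"
    have "c * (1 - real (draws I t) / real m) \<le> nrm d (grad d f (iter d F gam x0 upd I t))"
    proof (cases "draws I t < m")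
      case True
      have "c * (1 - real (draws I t) / real m) \<le> c * 1" using c by (intro mult_left_mono) auto
      also have "\<dots> \<le> nrm d (grad d f (iter d F gam x0 upd I t))"
        unfolding c_def mult_1_right by (rule grad_f_norm_ge[OF iterates_in_W[OF P gam] True])
      finally show ?thesis .
    next
      case False
      then have "c * (1 - real (draws I t) / real m) \<le> 0" using c m by (intro mult_nonneg_nonpos) auto
      then show ?thesis using nrm_nonneg order_trans by blast
    qed
    moreover have "(\<Prod>k<t. p (I k)) \<ge> 0" using I p by (intro prod_nonneg) auto
    ultimately show "(\<Prod>k<t. p (I k)) * (c * (1 - real (draws I t) / real m)) \<le> (\<Prod>k<t. p (I k)) * nrm d (grad d f (iter d F gam x0 upd I t))"
      by (rule mult_left_mono)
  qed
  finally show ?thesis unfolding exp_grad_norm_def c_def f_def .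
qed

end

section \<open>Choice of the scale, the height and the constant\<close>

theorem theoremF1:
  shows "\<exists>c::real. c > 0 \<and>
    (\<forall>(n::nat) (L::real) (\<sigma>::real) (\<Delta>::real) (\<epsilon>::real).
      n \<ge> 2 \<and> L > 0 \<and> \<sigma> > 0 \<and> \<Delta> > 0 \<and> \<epsilon> > 0 \<longrightarrow>
      (let \<alpha> = min 1 (min ((sqrt 3 + 1) * real n * \<sigma> / (30 * L)) (real n / 180));
           d = nat \<lfloor>\<Delta> * L * sqrt \<alpha> / (40824 * real n * \<epsilon>\<^sup>2)\<rfloor> + 1
       in \<epsilon>\<^sup>2 \<le> \<Delta> * L * \<alpha> / (81648 * real n) \<longrightarrow>
          (\<forall>p x0 gam upd. pifo n d p x0 gam upd \<and> (\<forall>t\<ge>1. 1 / gam t > \<sigma>) \<longrightarrow>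
             (\<exists>F :: nat \<Rightarrow> vec \<Rightarrow> real.
                (\<forall>i<n. smooth d (- \<sigma>) L (F i)) \<and>
                (let f = (\<lambda>x. (\<Sum>i<n. F i x) / real n) in
                   bdd_below (f ` vsp d) \<and> f x0 - Inf (f ` vsp d) \<le> \<Delta>) \<and>
                (\<forall>t::nat. real t \<le> c * \<Delta> * L * sqrt \<alpha> / \<epsilon>\<^sup>2 \<longrightarrow>
                   exp_grad_norm n d F p x0 gam upd t \<ge> \<epsilon>)))))"
proof (intro exI[of _ "1 / 653184"] conjI allI impI)
  fix n :: nat and L \<sigma> \<Delta> \<epsilon> :: real
  assume asm: "n \<ge> 2 \<and> L > 0 \<and> \<sigma> > 0 \<and> \<Delta> > 0 \<and> \<epsilon> > 0"
  define \<alpha> where "\<alpha> = min 1 (min ((sqrt 3 + 1) * real n * \<sigma> / (30 * L)) (real n / 180))"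
  define X where "X = \<Delta> * L * sqrt \<alpha> / (40824 * real n * \<epsilon>\<^sup>2)"
  define m where "m = nat \<lfloor>X\<rfloor>"
  have n: "n \<ge> 2" and pos: "L > 0" "\<sigma> > 0" "\<Delta> > 0" "\<epsilon> > 0" using asm by auto
  have n0: "real n > 0" using n by simp
  have \<alpha>: "\<alpha> > 0" "\<alpha> \<le> 1" "\<alpha> \<le> (sqrt 3 + 1) * real n * \<sigma> / (30 * L)"
    using pos n0 by (auto simp: \<alpha>_def add_pos_pos)
  define w where "w = sqrt \<alpha>"
  have w: "0 < w" "w \<le> 1" and w2: "w\<^sup>2 = \<alpha>" using \<alpha> by (auto simp: w_def)
  \<comment> \<open>With \<open>w\<^sup>2 \<le> 1 \<le> n\<close>, this scale keeps
    \<open>K * (2 * n + w\<^sup>2)\<close> within \<open>L\<close>.\<close>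
  define K where "K = L / (3 * real n)"
  have K: "K > 0" using pos n0 by (simp add: K_def)
  \<comment> \<open>The scale at which the gradient bound \<open>K * b * sqrt (w ^ 3) / 27\<close> equals \<open>2 * \<epsilon>\<close>.\<close>
  define b where "b = 54 * \<epsilon> / (K * sqrt (w ^ 3))"
  have b: "b > 0" using K w pos by (simp add: b_def)
  have goal: "\<exists>F :: nat \<Rightarrow> vec \<Rightarrow> real.
                (\<forall>i<n. smooth (m + 1) (- \<sigma>) L (F i)) \<and>
                (let f = (\<lambda>x. (\<Sum>i<n. F i x) / real n) in
                   bdd_below (f ` vsp (m + 1)) \<and> f x0 - Inf (f ` vsp (m + 1)) \<le> \<Delta>) \<and>
                (\<forall>t::nat. real t \<le> 1 / 653184 * \<Delta> * L * sqrt \<alpha> / \<epsilon>\<^sup>2 \<longrightarrow>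
                   exp_grad_norm n (m + 1) F p x0 gam upd t \<ge> \<epsilon>)"
    if eps: "\<epsilon>\<^sup>2 \<le> \<Delta> * L * \<alpha> / (81648 * real n)"
      and P: "pifo n (m + 1) p x0 gam upd" and gam: "\<forall>t\<ge>1. 1 / gam t > \<sigma>" for p x0 gam upd
  proof -
    define Y where "Y = real n * \<epsilon>\<^sup>2 / L"
    have Y: "Y > 0" using n0 pos by (simp add: Y_def)
    have Yw: "Y \<le> \<Delta> * w\<^sup>2 / 81648" using eps n0 pos by (simp add: Y_def w2 field_simps)
    have X: "X = \<Delta> * w / (40824 * Y)" using pos by (simp add: X_def Y_def w_def field_simps)
    have "2 * w * (40824 * Y) \<le> w * (w * (w * \<Delta>))"
      using mult_left_mono[OF Yw, of "81648 * w"] w by (simp add: power2_eq_square mult_ac)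
    also have "\<dots> \<le> w * (w * \<Delta>)" using w pos by (intro mult_left_mono mult_left_le_one_le) auto
    \<comment> \<open>As \<open>81648 = 2 * 40824\<close>, the assumption on
      \<open>\<epsilon>\<close> yields this bound, so rounding down to \<open>m\<close> loses at
      most half of \<open>X\<close>.\<close>
    finally have X2: "X \<ge> 2" unfolding X using Y w by (simp add: field_simps)
    have m: "real m \<le> X" "real m \<ge> X / 2" using X2 by (auto simp: m_def) linarith
    have m0: "m > 0" using m X2 by simp
    obtain A B where AB: "A < n" "B < n" "A \<noteq> B" and rare: "p A + p B \<le> 3 / real n"
      using exists_two_rare_indices[OF n, of p] P by (auto simp: pifo_def)
    have x0: "x0 \<in> vsp (Suc m)" using P by (simp add: pifo_def)
    obtain H where H: "reflection (Suc m) x0 H" using householder_reflection_exists[OF _ x0] by auto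
    have K\<sigma>: "K * w\<^sup>2 \<le> \<sigma>"
    proof -
      have "K * w\<^sup>2 \<le> K * ((sqrt 3 + 1) * real n * \<sigma> / (30 * L))"
        unfolding w2 using K \<alpha> by (intro mult_left_mono) auto
      also have "\<dots> = (sqrt 3 + 1) / 90 * \<sigma>" using pos n0 by (simp add: K_def field_simps)
      also have "\<dots> \<le> 1 * \<sigma>"
        using pos real_sqrt_le_mono[of 3 4] by (intro mult_right_mono) auto
      finally show ?thesis by simp
    qed
    have KL: "K * (2 * real n + w\<^sup>2) \<le> L"
    proof -
      have "K * (2 * real n + w\<^sup>2) \<le> K * (3 * real n)" using K n w2 \<alpha> by (intro mult_left_mono) auto
      then show ?thesis using n0 by (simp add: K_def)
    qed
    interpret chain m n A B K w b \<sigma> L x0 H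
      by unfold_locales (use AB K w b K\<sigma> KL H x0 in auto)
    have "K * b\<^sup>2 = 2916 * \<epsilon>\<^sup>2 / (K * w ^ 3)"
      using K w by (simp add: b_def power_divide power_mult_distrib) (simp add: power2_eq_square)
    also have "\<dots> = 8748 * Y / w ^ 3" using pos n0 by (simp add: K_def Y_def field_simps)
    finally have Kb: "K * b\<^sup>2 = 8748 * Y / w ^ 3" .
    have bdd: "bdd_below (f ` vsp d)" unfolding bdd_below_def using f_ge by auto
    have "Inf (f ` vsp d) \<ge> - (K * w\<^sup>2 * real m * b\<^sup>2 / 4)"
      by (rule cInf_greatest) (use x0 f_ge in auto)
    then have "f x0 - Inf (f ` vsp d) \<le> K * b\<^sup>2 * (w / 2 + w\<^sup>2 * real m / 4)"
      unfolding f_x0[OF m0] by (simp add: field_simps)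
    also have "\<dots> = 4374 * Y / w\<^sup>2 + 2187 * Y * real m / w"
      unfolding Kb using w by (simp add: field_simps power2_eq_square power3_eq_cube)
    \<comment> \<open>The first summand is controlled by the assumption on
      \<open>\<epsilon>\<close>, the second by \<open>m \<le> X\<close>; each is at most
      \<open>3 / 56 * \<Delta>\<close>.\<close>
    also have "\<dots> \<le> 4374 * \<Delta> / 81648 + 2187 * \<Delta> / 40824"
    proof (rule add_mono)
      show "4374 * Y / w\<^sup>2 \<le> 4374 * \<Delta> / 81648" using Yw w by (simp add: field_simps)
      have "Y * real m \<le> Y * X" using m Y by (intro mult_left_mono) auto
      also have "\<dots> = \<Delta> * w / 40824" using Y by (simp add: X)
      finally show "2187 * Y * real m / w \<le> 2187 * \<Delta> / 40824" using w by (simp add: field_simps)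
    qed
    also have "\<dots> \<le> \<Delta>" using pos by simp
    finally have gap: "f x0 - Inf (f ` vsp d) \<le> \<Delta>" .
    have c0: "K * b * sqrt (w ^ 3) / 27 = 2 * \<epsilon>" using K w by (simp add: b_def)
    have exp: "exp_grad_norm n d F p x0 gam upd t \<ge> \<epsilon>" if t: "real t \<le> 1 / 653184 * \<Delta> * L * sqrt \<alpha> / \<epsilon>\<^sup>2" for t
    proof -
      \<comment> \<open>\<open>653184 = 16 * 40824\<close>: a factor \<open>2\<close> pays for
        rounding \<open>X\<close> to \<open>m\<close>, and the remaining \<open>8\<close> limits the
        expected number of draws of \<open>A\<close> and \<open>B\<close> to
        \<open>3 / 8 * m\<close>.\<close>
      have "1 / 653184 * \<Delta> * L * sqrt \<alpha> / \<epsilon>\<^sup>2 = real n * X / 16" using n0 pos by (simp add: X_def field_simps)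
      then have "real t \<le> real n * X / 16" using t by (simp only:)
      then have "real t \<le> real n * (X / 2) / 8" by simp
      also have "\<dots> \<le> real n * real m / 8" using m n0 by (intro divide_right_mono mult_left_mono) auto
      finally have tm: "real t \<le> real n * real m / 8" .
      have "real t * (p A + p B) \<le> (real n * real m / 8) * (3 / real n)"
        using tm rare AB P by (intro mult_mono) (auto simp: pifo_def)
      also have "\<dots> = 3 / 8 * real m" using n0 by simp
      finally have "real t * (p A + p B) / real m \<le> 3 / 8" using m0 by (simp add: field_simps)
      \<comment> \<open>Of the remaining \<open>5 / 8\<close> only \<open>1 / 2\<close> is kept,
        matching the gradient level \<open>2 * \<epsilon>\<close>.\<close>
      then have "1 / 2 \<le> 1 - real t * (p A + p B) / real m" by linarith
      then have "2 * \<epsilon> * (1 / 2) \<le> 2 * \<epsilon> * (1 - real t * (p A + p B) / real m)"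
        using pos by (intro mult_left_mono) auto
      also have "\<dots> \<le> exp_grad_norm n d F p x0 gam upd t"
        using exp_grad_norm_ge[of p gam upd t] P gam m0 unfolding c0 by simp
      finally show ?thesis by simp
    qed
    show ?thesis
      by (rule exI[of _ F])
         (use quad_bounds_smooth[OF F_quad_bounds] bdd gap exp in \<open>auto simp: Let_def f_def[abs_def]\<close>)
  qed
  show "let \<alpha> = min 1 (min ((sqrt 3 + 1) * real n * \<sigma> / (30 * L)) (real n / 180));
           d = nat \<lfloor>\<Delta> * L * sqrt \<alpha> / (40824 * real n * \<epsilon>\<^sup>2)\<rfloor> + 1
       in \<epsilon>\<^sup>2 \<le> \<Delta> * L * \<alpha> / (81648 * real n) \<longrightarrow>
          (\<forall>p x0 gam upd. pifo n d p x0 gam upd \<and> (\<forall>t\<ge>1. 1 / gam t > \<sigma>) \<longrightarrow>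
             (\<exists>F :: nat \<Rightarrow> vec \<Rightarrow> real.
                (\<forall>i<n. smooth d (- \<sigma>) L (F i)) \<and>
                (let f = (\<lambda>x. (\<Sum>i<n. F i x) / real n) in
                   bdd_below (f ` vsp d) \<and> f x0 - Inf (f ` vsp d) \<le> \<Delta>) \<and>
                (\<forall>t::nat. real t \<le> 1 / 653184 * \<Delta> * L * sqrt \<alpha> / \<epsilon>\<^sup>2 \<longrightarrow>
                   exp_grad_norm n d F p x0 gam upd t \<ge> \<epsilon>)))"
    unfolding Let_def \<alpha>_def[symmetric] X_def[symmetric] m_def[symmetric]
    by (intro impI allI, elim conjE) (rule goal[unfolded Let_def])
qed simp

end
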